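(* Let $R$ be a commutative ring and let $M$ and $N$ be $R$-Lie algebras equipped with compatible actions of $M$ on $N$ and of $N$ on $M$. Let $M\bowtie N$ be their Peiffer product, with quotient map $q\colon M+N\to M\bowtie N$, and let $l_M:=q\circ i_M\colon M\to M\bowtie N$ and $l_N:=q\circ i_N\colon N\to M\bowtie N$, where $i_M\colon M\to M+N$ and $i_N\colon N\to M+N$ are the coproduct inclusions. Then $(M\xrightarrow{l_M}M\bowtie N,\xi^{M\bowtie N}_M)$ and $(N\xrightarrow{l_N}M\bowtie N,\xi^{M\bowtie N}_N)$ are crossed modules of $R$-Lie algebras, where $\xi^{M\bowtie N}_M$ and $\xi^{M\bowtie N}_N$ are the actions of $M\bowtie N$ on $M$ and on $N$ induced by the coproduct actions of $M+N$.
   Context: An $R$-Lie algebra is an $R$-module with an $R$-bilinear bracket satisfying $[x,x]=0$ and the Jacobi identity. $M+N$ denotes the coproduct in the category of $R$-Lie algebras; $M$ and $N$ are identified with their images in $M+N$. An action of an $R$-Lie algebra $P$ on an $R$-Lie algebra $M$ is an $R$-bilinear map $P\times M\to M$, $(p,m)\mapsto {}^{p}m$, such that ${}^{[p,p']}m={}^{p}({}^{p'}m)-{}^{p'}({}^{p}m)$ and ${}^{p}[m,m']=[{}^{p}m,m']+[m,{}^{p}m']$. (The paper uses actions and the equivalent notion of internal actions interchangeably.) Actions of $M$ on $N$ and of $N$ on $M$ are compatible if for all $m,m'\in M$, $n,n'\in N$: ${}^{({}^{n}m)}n'=[n',{}^{m}n]$ and ${}^{({}^{m}n)}m'=[m',{}^{n}m]$.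 A crossed module of $R$-Lie algebras $(M\xrightarrow{\partial}P,\psi)$ consists of a Lie algebra morphism $\partial\colon M\to P$ and an action $\psi$ of $P$ on $M$ such that ${}^{\partial(m)}m'=[m,m']$ and $\partial({}^{p}m)=[p,\partial(m)]$ for all $m,m'\in M$, $p\in P$. Peiffer product: $M\bowtie N:=(M+N)/K$, where $K$ is the ideal of $M+N$ generated by the elements ${}^{n}m-[n,m]$ and ${}^{m}n-[m,n]$ for $m\in M$, $n\in N$. Coproduct actions: $M+N$ acts on $M$ by the unique action for which $m\in M$ acts by $\overline{m}\mapsto[m,\overline{m}]$ and $n\in N$ acts by the given action $\overline{m}\mapsto{}^{n}\overline{m}$; symmetrically $M+N$ acts on $N$, with $N$ acting by its bracket and $M$ acting by the given action. When the given actions are compatible, $K$ acts trivially on both $M$ and $N$, and $\xi^{M\bowtie N}_M$, $\xi^{M\bowtie N}_N$ denote the unique actions of $M\bowtie N$ on $M$ and on $N$ satisfying ${}^{q(s)}m={}^{s}m$ and ${}^{q(s)}n={}^{s}n$ for all $s\in M+N$, $m\in M$, $n\in N$. *)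

theory Defs
  imports "HOL-Algebra.Module" "HOL-Algebra.AbelCoset"
begin

section \<open>Lie algebras over a commutative ring\<close>

text \<open>As for \<^locale>\<open>module\<close>, the fields \<^const>\<open>mult\<close> and \<^const>\<open>one\<close> inherited
  from the ring record are not used.\<close>

record ('a, 'b) lie_algebra = "('a, 'b) module" +
  bracket :: "'b \<Rightarrow> 'b \<Rightarrow> 'b"  (\<open>\<lbrakk>_,/ _\<rbrakk>\<index>\<close>)

locale lie_algebra = module R L
  for R :: "('r, 'x) ring_scheme" (structure)
    and L :: "('r, 'a, 'y) lie_algebra_scheme" (structure) +
  assumes bracket_closed [simp, intro]:
      "\<lbrakk> x \<in> carrier L; y \<in> carrier L \<rbrakk> \<Longrightarrow> \<lbrakk>x, y\<rbrakk>\<^bsub>L\<^esub> \<in> carrier L"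
    and bracket_add_left:
      "\<lbrakk> x \<in> carrier L; y \<in> carrier L; z \<in> carrier L \<rbrakk> \<Longrightarrow>
        \<lbrakk>x \<oplus>\<^bsub>L\<^esub> y, z\<rbrakk>\<^bsub>L\<^esub> = \<lbrakk>x, z\<rbrakk>\<^bsub>L\<^esub> \<oplus>\<^bsub>L\<^esub> \<lbrakk>y, z\<rbrakk>\<^bsub>L\<^esub>"
    and bracket_add_right:
      "\<lbrakk> x \<in> carrier L; y \<in> carrier L; z \<in> carrier L \<rbrakk> \<Longrightarrow>
        \<lbrakk>x, y \<oplus>\<^bsub>L\<^esub> z\<rbrakk>\<^bsub>L\<^esub> = \<lbrakk>x, y\<rbrakk>\<^bsub>L\<^esub> \<oplus>\<^bsub>L\<^esub> \<lbrakk>x, z\<rbrakk>\<^bsub>L\<^esub>"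
    and bracket_smult_left:
      "\<lbrakk> r \<in> carrier R; x \<in> carrier L; y \<in> carrier L \<rbrakk> \<Longrightarrow>
        \<lbrakk>r \<odot>\<^bsub>L\<^esub> x, y\<rbrakk>\<^bsub>L\<^esub> = r \<odot>\<^bsub>L\<^esub> \<lbrakk>x, y\<rbrakk>\<^bsub>L\<^esub>"
    and bracket_smult_right:
      "\<lbrakk> r \<in> carrier R; x \<in> carrier L; y \<in> carrier L \<rbrakk> \<Longrightarrow>
        \<lbrakk>x, r \<odot>\<^bsub>L\<^esub> y\<rbrakk>\<^bsub>L\<^esub> = r \<odot>\<^bsub>L\<^esub> \<lbrakk>x, y\<rbrakk>\<^bsub>L\<^esub>"
    and bracket_self:
      "x \<in> carrier L \<Longrightarrow> \<lbrakk>x, x\<rbrakk>\<^bsub>L\<^esub> = \<zero>\<^bsub>L\<^esub>"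
    and jacobi:
      "\<lbrakk> x \<in> carrier L; y \<in> carrier L; z \<in> carrier L \<rbrakk> \<Longrightarrow>
        \<lbrakk>x, \<lbrakk>y, z\<rbrakk>\<^bsub>L\<^esub>\<rbrakk>\<^bsub>L\<^esub> \<oplus>\<^bsub>L\<^esub> \<lbrakk>y, \<lbrakk>z, x\<rbrakk>\<^bsub>L\<^esub>\<rbrakk>\<^bsub>L\<^esub> \<oplus>\<^bsub>L\<^esub> \<lbrakk>z, \<lbrakk>x, y\<rbrakk>\<^bsub>L\<^esub>\<rbrakk>\<^bsub>L\<^esub> = \<zero>\<^bsub>L\<^esub>"

definition lie_hom ::
  "('r, 'x) ring_scheme \<Rightarrow> ('r, 'a, 'y) lie_algebra_scheme \<Rightarrow> ('r, 'b, 'z) lie_algebra_scheme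
    \<Rightarrow> ('a \<Rightarrow> 'b) set" where
  "lie_hom R L L' =
    {f \<in> carrier L \<rightarrow> carrier L'.
      (\<forall>x\<in>carrier L. \<forall>y\<in>carrier L. f (x \<oplus>\<^bsub>L\<^esub> y) = f x \<oplus>\<^bsub>L'\<^esub> f y) \<and>
      (\<forall>r\<in>carrier R. \<forall>x\<in>carrier L. f (r \<odot>\<^bsub>L\<^esub> x) = r \<odot>\<^bsub>L'\<^esub> f x) \<and>
      (\<forall>x\<in>carrier L. \<forall>y\<in>carrier L. f \<lbrakk>x, y\<rbrakk>\<^bsub>L\<^esub> = \<lbrakk>f x, f y\<rbrakk>\<^bsub>L'\<^esub>)}"


section \<open>Actions and crossed modules\<close>

locale lie_action =
  P: lie_algebra R P + M: lie_algebra R M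
  for R :: "('r, 'x) ring_scheme" (structure)
    and P :: "('r, 'p, 'y) lie_algebra_scheme" (structure)
    and M :: "('r, 'm, 'z) lie_algebra_scheme" (structure) +
  fixes act :: "'p \<Rightarrow> 'm \<Rightarrow> 'm"
  assumes act_closed:
      "\<lbrakk> p \<in> carrier P; m \<in> carrier M \<rbrakk> \<Longrightarrow> act p m \<in> carrier M"
    and act_add_left:
      "\<lbrakk> p \<in> carrier P; p' \<in> carrier P; m \<in> carrier M \<rbrakk> \<Longrightarrow>
        act (p \<oplus>\<^bsub>P\<^esub> p') m = act p m \<oplus>\<^bsub>M\<^esub> act p' m"
    and act_add_right:
      "\<lbrakk> p \<in> carrier P; m \<in> carrier M; m' \<in> carrier M \<rbrakk> \<Longrightarrow>
        act p (m \<oplus>\<^bsub>M\<^esub> m') = act p m \<oplus>\<^bsub>M\<^esub> act p m'"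
    and act_smult_left:
      "\<lbrakk> r \<in> carrier R; p \<in> carrier P; m \<in> carrier M \<rbrakk> \<Longrightarrow>
        act (r \<odot>\<^bsub>P\<^esub> p) m = r \<odot>\<^bsub>M\<^esub> act p m"
    and act_smult_right:
      "\<lbrakk> r \<in> carrier R; p \<in> carrier P; m \<in> carrier M \<rbrakk> \<Longrightarrow>
        act p (r \<odot>\<^bsub>M\<^esub> m) = r \<odot>\<^bsub>M\<^esub> act p m"
    and act_bracket_left:
      "\<lbrakk> p \<in> carrier P; p' \<in> carrier P; m \<in> carrier M \<rbrakk> \<Longrightarrow>
        act \<lbrakk>p, p'\<rbrakk>\<^bsub>P\<^esub> m = act p (act p' m) \<ominus>\<^bsub>M\<^esub> act p' (act p m)"
    and act_bracket_right:
      "\<lbrakk> p \<in> carrier P; m \<in> carrier M; m' \<in> carrier M \<rbrakk> \<Longrightarrow>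
        act p \<lbrakk>m, m'\<rbrakk>\<^bsub>M\<^esub> = \<lbrakk>act p m, m'\<rbrakk>\<^bsub>M\<^esub> \<oplus>\<^bsub>M\<^esub> \<lbrakk>m, act p m'\<rbrakk>\<^bsub>M\<^esub>"

text \<open>\<open>\<alpha>\<close> is the action of \<open>M\<close> on \<open>N\<close> and \<open>\<beta>\<close> the action of \<open>N\<close> on \<open>M\<close>.\<close>

definition compatible_actions ::
  "('r, 'm, 'y) lie_algebra_scheme \<Rightarrow> ('r, 'n, 'z) lie_algebra_scheme
    \<Rightarrow> ('m \<Rightarrow> 'n \<Rightarrow> 'n) \<Rightarrow> ('n \<Rightarrow> 'm \<Rightarrow> 'm) \<Rightarrow> bool" where
  "compatible_actions M N \<alpha> \<beta> \<longleftrightarrow>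
    (\<forall>m\<in>carrier M. \<forall>n\<in>carrier N. \<forall>n'\<in>carrier N. \<alpha> (\<beta> n m) n' = \<lbrakk>n', \<alpha> m n\<rbrakk>\<^bsub>N\<^esub>) \<and>
    (\<forall>m\<in>carrier M. \<forall>m'\<in>carrier M. \<forall>n\<in>carrier N. \<beta> (\<alpha> m n) m' = \<lbrakk>m', \<beta> n m\<rbrakk>\<^bsub>M\<^esub>)"

locale lie_crossed_module =
  lie_action R P M act
  for R :: "('r, 'x) ring_scheme" (structure)
    and M :: "('r, 'm, 'z) lie_algebra_scheme" (structure)
    and P :: "('r, 'p, 'y) lie_algebra_scheme" (structure)
    and d :: "'m \<Rightarrow> 'p"
    and act :: "'p \<Rightarrow> 'm \<Rightarrow> 'm" +
  assumes boundary_hom: "d \<in> lie_hom R M P"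
    and peiffer_identity:
      "\<lbrakk> m \<in> carrier M; m' \<in> carrier M \<rbrakk> \<Longrightarrow> act (d m) m' = \<lbrakk>m, m'\<rbrakk>\<^bsub>M\<^esub>"
    and boundary_equivariant:
      "\<lbrakk> p \<in> carrier P; m \<in> carrier M \<rbrakk> \<Longrightarrow> d (act p m) = \<lbrakk>p, d m\<rbrakk>\<^bsub>P\<^esub>"


section \<open>The coproduct of two Lie algebras\<close>

text \<open>The coproduct is presented by generators and relations: formal expressions in the
  elements of \<open>M\<close> and \<open>N\<close>, modulo the congruence generated by the axioms of an
  \<open>R\<close>-Lie algebra and by the requirement that both inclusions are morphisms. That this has the
  universal property of the coproduct is proved below.\<close>

datatype ('r, 'm, 'n) lie_term =
    InM 'm
  | InN 'n
  | Zero
  | Add "('r, 'm, 'n) lie_term" "('r, 'm, 'n) lie_term"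
  | Smult 'r "('r, 'm, 'n) lie_term"
  | Bracket "('r, 'm, 'n) lie_term" "('r, 'm, 'n) lie_term"

inductive_set lie_terms ::
  "('r, 'x) ring_scheme \<Rightarrow> ('r, 'm, 'y) lie_algebra_scheme \<Rightarrow> ('r, 'n, 'z) lie_algebra_scheme
    \<Rightarrow> ('r, 'm, 'n) lie_term set"
  for R M N where
  InM: "m \<in> carrier M \<Longrightarrow> InM m \<in> lie_terms R M N"
| InN: "n \<in> carrier N \<Longrightarrow> InN n \<in> lie_terms R M N"
| Zero: "Zero \<in> lie_terms R M N"
| Add: "\<lbrakk> s \<in> lie_terms R M N; t \<in> lie_terms R M N \<rbrakk> \<Longrightarrow> Add s t \<in> lie_terms R M N"
| Smult: "\<lbrakk> r \<in> carrier R; t \<in> lie_terms R M N \<rbrakk> \<Longrightarrow> Smult r t \<in> lie_terms R M N"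
| Bracket: "\<lbrakk> s \<in> lie_terms R M N; t \<in> lie_terms R M N \<rbrakk> \<Longrightarrow> Bracket s t \<in> lie_terms R M N"

text \<open>Additive inverses need no constructor: by \<open>smult_zero\<close> below, \<open>(- 1) \<odot> t\<close> is an
  inverse of \<open>t\<close>.\<close>

inductive lie_eqv ::
  "('r, 'x) ring_scheme \<Rightarrow> ('r, 'm, 'y) lie_algebra_scheme \<Rightarrow> ('r, 'n, 'z) lie_algebra_scheme
    \<Rightarrow> ('r, 'm, 'n) lie_term \<Rightarrow> ('r, 'm, 'n) lie_term \<Rightarrow> bool"
  for R M N where
  refl: "t \<in> lie_terms R M N \<Longrightarrow> lie_eqv R M N t t"
| sym: "lie_eqv R M N s t \<Longrightarrow> lie_eqv R M N t s"
| trans: "\<lbrakk> lie_eqv R M N s t; lie_eqv R M N t u \<rbrakk> \<Longrightarrow> lie_eqv R M N s u"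
| cong_add: "\<lbrakk> lie_eqv R M N s s'; lie_eqv R M N t t' \<rbrakk> \<Longrightarrow>
    lie_eqv R M N (Add s t) (Add s' t')"
| cong_smult: "\<lbrakk> r \<in> carrier R; lie_eqv R M N t t' \<rbrakk> \<Longrightarrow>
    lie_eqv R M N (Smult r t) (Smult r t')"
| cong_bracket: "\<lbrakk> lie_eqv R M N s s'; lie_eqv R M N t t' \<rbrakk> \<Longrightarrow>
    lie_eqv R M N (Bracket s t) (Bracket s' t')"
| add_assoc: "\<lbrakk> s \<in> lie_terms R M N; t \<in> lie_terms R M N; u \<in> lie_terms R M N \<rbrakk> \<Longrightarrow>
    lie_eqv R M N (Add (Add s t) u) (Add s (Add t u))"
| add_comm: "\<lbrakk> s \<in> lie_terms R M N; t \<in> lie_terms R M N \<rbrakk> \<Longrightarrow>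
    lie_eqv R M N (Add s t) (Add t s)"
| add_zero: "t \<in> lie_terms R M N \<Longrightarrow> lie_eqv R M N (Add Zero t) t"
| smult_zero: "t \<in> lie_terms R M N \<Longrightarrow> lie_eqv R M N (Smult \<zero>\<^bsub>R\<^esub> t) Zero"
| smult_one: "t \<in> lie_terms R M N \<Longrightarrow> lie_eqv R M N (Smult \<one>\<^bsub>R\<^esub> t) t"
| smult_add: "\<lbrakk> r \<in> carrier R; r' \<in> carrier R; t \<in> lie_terms R M N \<rbrakk> \<Longrightarrow>
    lie_eqv R M N (Smult (r \<oplus>\<^bsub>R\<^esub> r') t) (Add (Smult r t) (Smult r' t))"
| smult_Add: "\<lbrakk> r \<in> carrier R; s \<in> lie_terms R M N; t \<in> lie_terms R M N \<rbrakk> \<Longrightarrow>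
    lie_eqv R M N (Smult r (Add s t)) (Add (Smult r s) (Smult r t))"
| smult_assoc: "\<lbrakk> r \<in> carrier R; r' \<in> carrier R; t \<in> lie_terms R M N \<rbrakk> \<Longrightarrow>
    lie_eqv R M N (Smult (r \<otimes>\<^bsub>R\<^esub> r') t) (Smult r (Smult r' t))"
| bracket_add_left: "\<lbrakk> s \<in> lie_terms R M N; t \<in> lie_terms R M N; u \<in> lie_terms R M N \<rbrakk> \<Longrightarrow>
    lie_eqv R M N (Bracket (Add s t) u) (Add (Bracket s u) (Bracket t u))"
| bracket_add_right: "\<lbrakk> s \<in> lie_terms R M N; t \<in> lie_terms R M N; u \<in> lie_terms R M N \<rbrakk> \<Longrightarrow>
    lie_eqv R M N (Bracket s (Add t u)) (Add (Bracket s t) (Bracket s u))"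
| bracket_smult_left: "\<lbrakk> r \<in> carrier R; s \<in> lie_terms R M N; t \<in> lie_terms R M N \<rbrakk> \<Longrightarrow>
    lie_eqv R M N (Bracket (Smult r s) t) (Smult r (Bracket s t))"
| bracket_smult_right: "\<lbrakk> r \<in> carrier R; s \<in> lie_terms R M N; t \<in> lie_terms R M N \<rbrakk> \<Longrightarrow>
    lie_eqv R M N (Bracket s (Smult r t)) (Smult r (Bracket s t))"
| bracket_self: "t \<in> lie_terms R M N \<Longrightarrow> lie_eqv R M N (Bracket t t) Zero"
| jacobi: "\<lbrakk> s \<in> lie_terms R M N; t \<in> lie_terms R M N; u \<in> lie_terms R M N \<rbrakk> \<Longrightarrow>
    lie_eqv R M N
      (Add (Add (Bracket s (Bracket t u)) (Bracket t (Bracket u s))) (Bracket u (Bracket s t)))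
      Zero"
| InM_add: "\<lbrakk> m \<in> carrier M; m' \<in> carrier M \<rbrakk> \<Longrightarrow>
    lie_eqv R M N (InM (m \<oplus>\<^bsub>M\<^esub> m')) (Add (InM m) (InM m'))"
| InM_smult: "\<lbrakk> r \<in> carrier R; m \<in> carrier M \<rbrakk> \<Longrightarrow>
    lie_eqv R M N (InM (r \<odot>\<^bsub>M\<^esub> m)) (Smult r (InM m))"
| InM_bracket: "\<lbrakk> m \<in> carrier M; m' \<in> carrier M \<rbrakk> \<Longrightarrow>
    lie_eqv R M N (InM \<lbrakk>m, m'\<rbrakk>\<^bsub>M\<^esub>) (Bracket (InM m) (InM m'))"
| InN_add: "\<lbrakk> n \<in> carrier N; n' \<in> carrier N \<rbrakk> \<Longrightarrow>
    lie_eqv R M N (InN (n \<oplus>\<^bsub>N\<^esub> n')) (Add (InN n) (InN n'))"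
| InN_smult: "\<lbrakk> r \<in> carrier R; n \<in> carrier N \<rbrakk> \<Longrightarrow>
    lie_eqv R M N (InN (r \<odot>\<^bsub>N\<^esub> n)) (Smult r (InN n))"
| InN_bracket: "\<lbrakk> n \<in> carrier N; n' \<in> carrier N \<rbrakk> \<Longrightarrow>
    lie_eqv R M N (InN \<lbrakk>n, n'\<rbrakk>\<^bsub>N\<^esub>) (Bracket (InN n) (InN n'))"

definition lie_class ::
  "('r, 'x) ring_scheme \<Rightarrow> ('r, 'm, 'y) lie_algebra_scheme \<Rightarrow> ('r, 'n, 'z) lie_algebra_scheme
    \<Rightarrow> ('r, 'm, 'n) lie_term \<Rightarrow> ('r, 'm, 'n) lie_term set" where
  "lie_class R M N t = {s. lie_eqv R M N t s}"

definition lie_coproduct ::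
  "('r, 'x) ring_scheme \<Rightarrow> ('r, 'm, 'y) lie_algebra_scheme \<Rightarrow> ('r, 'n, 'z) lie_algebra_scheme
    \<Rightarrow> ('r, ('r, 'm, 'n) lie_term set) lie_algebra" where
  "lie_coproduct R M N =
    \<lparr>carrier = lie_class R M N ` lie_terms R M N,
     mult = undefined,
     one = undefined,
     zero = lie_class R M N Zero,
     add = (\<lambda>A B. \<Union>s\<in>A. \<Union>t\<in>B. lie_class R M N (Add s t)),
     smult = (\<lambda>r A. \<Union>t\<in>A. lie_class R M N (Smult r t)),
     bracket = (\<lambda>A B. \<Union>s\<in>A. \<Union>t\<in>B. lie_class R M N (Bracket s t))\<rparr>"

definition coproduct_inM ::
  "('r, 'x) ring_scheme \<Rightarrow> ('r, 'm, 'y) lie_algebra_scheme \<Rightarrow> ('r, 'n, 'z) lie_algebra_scheme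
    \<Rightarrow> 'm \<Rightarrow> ('r, 'm, 'n) lie_term set" where
  "coproduct_inM R M N m = lie_class R M N (InM m)"

definition coproduct_inN ::
  "('r, 'x) ring_scheme \<Rightarrow> ('r, 'm, 'y) lie_algebra_scheme \<Rightarrow> ('r, 'n, 'z) lie_algebra_scheme
    \<Rightarrow> 'n \<Rightarrow> ('r, 'm, 'n) lie_term set" where
  "coproduct_inN R M N n = lie_class R M N (InN n)"

context
  fixes R :: "('r, 'x) ring_scheme"
    and M :: "('r, 'm, 'y) lie_algebra_scheme"
    and N :: "('r, 'n, 'z) lie_algebra_scheme"
  assumes M: "lie_algebra R M" and N: "lie_algebra R N"
begin

interpretation M: lie_algebra R M by (rule M)
interpretation N: lie_algebra R N by (rule N)

private abbreviation "T \<equiv> lie_terms R M N"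
private abbreviation "E \<equiv> lie_eqv R M N"
private abbreviation "C \<equiv> lie_class R M N"

private lemma eqv_terms: "E s t \<Longrightarrow> s \<in> T \<and> t \<in> T"
  by (induction rule: lie_eqv.induct) (auto intro: lie_terms.intros)

private lemma class_eq: "E s t \<Longrightarrow> C s = C t"
  unfolding lie_class_def by (blast intro: lie_eqv.sym lie_eqv.trans)

private lemma class_eqD: "s \<in> T \<Longrightarrow> C s = C t \<Longrightarrow> E t s"
  unfolding lie_class_def using lie_eqv.refl by blast

private lemma class_self: "t \<in> T \<Longrightarrow> t \<in> C t"
  unfolding lie_class_def by (simp add: lie_eqv.refl)

private lemma class_ne: "t \<in> T \<Longrightarrow> C t \<noteq> {}"
  using class_self by blast

lemma coproduct_add:
  assumes "s \<in> T" "t \<in> T"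
  shows "C s \<oplus>\<^bsub>lie_coproduct R M N\<^esub> C t = C (Add s t)"
proof -
  have "C (Add s' t') = C (Add s t)" if "s' \<in> C s" "t' \<in> C t" for s' t'
    by (rule class_eq, rule lie_eqv.sym, rule lie_eqv.cong_add)
      (use that in \<open>auto simp: lie_class_def\<close>)
  then have "(\<Union>t'\<in>C t. C (Add s' t')) = C (Add s t)" if "s' \<in> C s" for s'
    using that by (intro UN_constant_eq[OF class_self[OF assms(2)]]) simp
  then show ?thesis
    by (simp add: lie_coproduct_def class_ne[OF assms(1)])
qed

lemma coproduct_bracket:
  assumes "s \<in> T" "t \<in> T"
  shows "\<lbrakk>C s, C t\<rbrakk>\<^bsub>lie_coproduct R M N\<^esub> = C (Bracket s t)"
proof -
  have "C (Bracket s' t') = C (Bracket s t)" if "s' \<in> C s" "t' \<in> C t" for s' t'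
    by (rule class_eq, rule lie_eqv.sym, rule lie_eqv.cong_bracket)
      (use that in \<open>auto simp: lie_class_def\<close>)
  then have "(\<Union>t'\<in>C t. C (Bracket s' t')) = C (Bracket s t)" if "s' \<in> C s" for s'
    using that by (intro UN_constant_eq[OF class_self[OF assms(2)]]) simp
  then show ?thesis
    by (simp add: lie_coproduct_def class_ne[OF assms(1)])
qed

lemma coproduct_smult:
  assumes "r \<in> carrier R" "t \<in> T"
  shows "r \<odot>\<^bsub>lie_coproduct R M N\<^esub> C t = C (Smult r t)"
proof -
  have "C (Smult r t') = C (Smult r t)" if "t' \<in> C t" for t'
    by (rule class_eq, rule lie_eqv.sym, rule lie_eqv.cong_smult)
      (use that assms(1) in \<open>auto simp: lie_class_def\<close>)
  then show ?thesis
    by (simp add: lie_coproduct_def class_ne[OF assms(2)])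
qed

lemma coproduct_carrier: "carrier (lie_coproduct R M N) = C ` T"
  and coproduct_zero: "\<zero>\<^bsub>lie_coproduct R M N\<^esub> = C Zero"
  by (simp_all add: lie_coproduct_def)

private lemmas coproduct_simps =
  coproduct_carrier coproduct_zero coproduct_add coproduct_bracket coproduct_smult

private lemmas coproduct_relations = lie_eqv.intros(7-)[THEN class_eq]

theorem lie_algebra_coproduct: "lie_algebra R (lie_coproduct R M N)"
proof -
  note [simp] = coproduct_simps lie_terms.intros imageI[where f = C]
  have neg: "E (Add (Smult (\<ominus>\<^bsub>R\<^esub> \<one>\<^bsub>R\<^esub>) t) t) Zero" if t: "t \<in> T" for t
  proof -
    have "E (Add (Smult (\<ominus>\<^bsub>R\<^esub> \<one>\<^bsub>R\<^esub>) t) t) (Add (Smult (\<ominus>\<^bsub>R\<^esub> \<one>\<^bsub>R\<^esub>) t) (Smult \<one>\<^bsub>R\<^esub> t))"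
      using t by (intro lie_eqv.cong_add lie_eqv.refl lie_eqv.sym[OF lie_eqv.smult_one]) auto
    moreover have "E (Smult (\<ominus>\<^bsub>R\<^esub> \<one>\<^bsub>R\<^esub> \<oplus>\<^bsub>R\<^esub> \<one>\<^bsub>R\<^esub>) t)
        (Add (Smult (\<ominus>\<^bsub>R\<^esub> \<one>\<^bsub>R\<^esub>) t) (Smult \<one>\<^bsub>R\<^esub> t))"
      using t by (intro lie_eqv.smult_add) auto
    moreover have "\<ominus>\<^bsub>R\<^esub> \<one>\<^bsub>R\<^esub> \<oplus>\<^bsub>R\<^esub> \<one>\<^bsub>R\<^esub> = \<zero>\<^bsub>R\<^esub>"
      by (simp add: M.R.l_neg)
    ultimately show ?thesis
      using lie_eqv.smult_zero[OF t] by (metis lie_eqv.sym lie_eqv.trans)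
  qed
  have ag: "abelian_group (lie_coproduct R M N)"
  proof (rule abelian_groupI)
    fix x assume "x \<in> carrier (lie_coproduct R M N)"
    then obtain t where t: "t \<in> T" "x = C t" by auto
    then show "\<exists>y\<in>carrier (lie_coproduct R M N). y \<oplus>\<^bsub>lie_coproduct R M N\<^esub> x = \<zero>\<^bsub>lie_coproduct R M N\<^esub>"
      using class_eq[OF neg[OF t(1)]] by (intro bexI[of _ "C (Smult (\<ominus>\<^bsub>R\<^esub> \<one>\<^bsub>R\<^esub>) t)"]) auto
  qed (clarsimp; rule coproduct_relations; assumption)+
  have mod: "module R (lie_coproduct R M N)"
    by (rule moduleI[OF M.R.is_cring ag]) (clarsimp; rule coproduct_relations; assumption)+
  show ?thesis
    by (rule lie_algebra.intro[OF mod], rule lie_algebra_axioms.intro)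
      (clarsimp; rule coproduct_relations; assumption)+
qed

lemma coproduct_inM_hom: "coproduct_inM R M N \<in> lie_hom R M (lie_coproduct R M N)"
  and coproduct_inN_hom: "coproduct_inN R M N \<in> lie_hom R N (lie_coproduct R M N)"
  unfolding lie_hom_def coproduct_inM_def coproduct_inN_def
  by (intro CollectI conjI ballI funcsetI;
      simp add: coproduct_simps lie_terms.intros coproduct_relations(15-) imageI[where f = C])+

private fun lie_eval ::
  "('r, 'l, 'w) lie_algebra_scheme \<Rightarrow> ('m \<Rightarrow> 'l) \<Rightarrow> ('n \<Rightarrow> 'l) \<Rightarrow> ('r, 'm, 'n) lie_term \<Rightarrow> 'l"
  where
  "lie_eval L f g (InM m) = f m"
| "lie_eval L f g (InN n) = g n"
| "lie_eval L f g Zero = \<zero>\<^bsub>L\<^esub>"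
| "lie_eval L f g (Add s t) = lie_eval L f g s \<oplus>\<^bsub>L\<^esub> lie_eval L f g t"
| "lie_eval L f g (Smult r t) = r \<odot>\<^bsub>L\<^esub> lie_eval L f g t"
| "lie_eval L f g (Bracket s t) = \<lbrakk>lie_eval L f g s, lie_eval L f g t\<rbrakk>\<^bsub>L\<^esub>"

theorem lie_coproduct_universal:
  fixes L :: "('r, 'l, 'w) lie_algebra_scheme"
  assumes L: "lie_algebra R L" and f: "f \<in> lie_hom R M L" and g: "g \<in> lie_hom R N L"
  shows "\<exists>!h. h \<in> lie_hom R (lie_coproduct R M N) L \<and>
    h \<in> extensional (carrier (lie_coproduct R M N)) \<and>
    (\<forall>m\<in>carrier M. h (coproduct_inM R M N m) = f m) \<and>
    (\<forall>n\<in>carrier N. h (coproduct_inN R M N n) = g n)"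
proof -
  interpret L: lie_algebra R L by (rule L)
  note [simp] = coproduct_simps
  let ?e = "lie_eval L f g"
  have closed: "?e t \<in> carrier L" if "t \<in> T" for t
    using that by induction (use f g in \<open>auto simp: lie_hom_def\<close>)
  have resp: "?e s = ?e t" if "E s t" for s t
    using that
  proof induction
    case (jacobi s t u)
    then show ?case by (simp add: closed L.jacobi)
  qed (use f g in \<open>auto simp: closed lie_hom_def L.M.a_ac L.smult_l_distr
        L.smult_r_distr L.smult_assoc1 L.bracket_add_left L.bracket_add_right
        L.bracket_smult_left L.bracket_smult_right L.bracket_self\<close>)
  define h where "h = restrict (\<lambda>A. ?e (SOME t. t \<in> A)) (C ` T)"
  have h: "h (C t) = ?e t" if "t \<in> T" for t
  proof -
    have "(SOME s. s \<in> C t) \<in> C t" using class_self[OF that] by (rule someI)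
    then have "E t (SOME s. s \<in> C t)" by (simp only: lie_class_def mem_Collect_eq)
    from resp[OF this] show ?thesis
      using that by (simp add: h_def)
  qed
  show ?thesis
  proof (rule ex1I[of _ h])
    show "h \<in> lie_hom R (lie_coproduct R M N) L \<and>
      h \<in> extensional (carrier (lie_coproduct R M N)) \<and>
      (\<forall>m\<in>carrier M. h (coproduct_inM R M N m) = f m) \<and>
      (\<forall>n\<in>carrier N. h (coproduct_inN R M N n) = g n)"
      by (auto simp: lie_hom_def h closed coproduct_inM_def coproduct_inN_def lie_terms.intros)
        (simp add: h_def)
  next
    fix k
    assume k: "k \<in> lie_hom R (lie_coproduct R M N) L \<and>
      k \<in> extensional (carrier (lie_coproduct R M N)) \<and>
      (\<forall>m\<in>carrier M. k (coproduct_inM R M N m) = f m) \<and>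
      (\<forall>n\<in>carrier N. k (coproduct_inN R M N n) = g n)"
    then have add: "k (C (Add s t)) = k (C s) \<oplus>\<^bsub>L\<^esub> k (C t)"
      and bra: "k (C (Bracket s t)) = \<lbrakk>k (C s), k (C t)\<rbrakk>\<^bsub>L\<^esub>" if "s \<in> T" "t \<in> T" for s t
      using that by (auto simp: lie_hom_def)
    from k have sm: "k (C (Smult r t)) = r \<odot>\<^bsub>L\<^esub> k (C t)" if "r \<in> carrier R" "t \<in> T" for r t
      using that by (auto simp: lie_hom_def)
    have kc: "k (C t) \<in> carrier L" if "t \<in> T" for t
      using k that by (auto simp: lie_hom_def)
    have z: "k (C Zero) = \<zero>\<^bsub>L\<^esub>"
    proof -
      have Z: "Zero \<in> T" by (rule lie_terms.Zero)
      have "C Zero = C (Smult \<zero>\<^bsub>R\<^esub> Zero)"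
        using class_eq[OF lie_eqv.smult_zero[OF Z]] by simp
      then show ?thesis
        using sm[OF M.R.zero_closed Z] kc[OF Z] by simp
    qed
    have "k (C t) = ?e t" if "t \<in> T" for t
      using that by induction
        (use k in \<open>auto simp: add bra sm z coproduct_inM_def coproduct_inN_def\<close>)
    then show "k = h"
      using k h by (intro extensionalityI[of k "C ` T"]) (auto simp: h_def)
  qed
qed

end


section \<open>The Peiffer product\<close>

definition lie_ideal ::
  "('r, 'x) ring_scheme \<Rightarrow> ('r, 'a, 'y) lie_algebra_scheme \<Rightarrow> 'a set \<Rightarrow> bool" where
  "lie_ideal R L I \<longleftrightarrow>
    submodule I R L \<and> (\<forall>x\<in>carrier L. \<forall>i\<in>I. \<lbrakk>x, i\<rbrakk>\<^bsub>L\<^esub> \<in> I \<and> \<lbrakk>i, x\<rbrakk>\<^bsub>L\<^esub> \<in> I)"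

definition gen_lie_ideal ::
  "('r, 'x) ring_scheme \<Rightarrow> ('r, 'a, 'y) lie_algebra_scheme \<Rightarrow> 'a set \<Rightarrow> 'a set" where
  "gen_lie_ideal R L S = \<Inter> {I. lie_ideal R L I \<and> S \<subseteq> I}"

definition lie_quotient ::
  "('r, 'a, 'y) lie_algebra_scheme \<Rightarrow> 'a set \<Rightarrow> ('r, 'a set) lie_algebra" where
  "lie_quotient L I =
    \<lparr>carrier = a_rcosets\<^bsub>L\<^esub> I,
     mult = undefined,
     one = undefined,
     zero = I,
     add = set_add L,
     smult = (\<lambda>r A. \<Union>x\<in>A. I +>\<^bsub>L\<^esub> (r \<odot>\<^bsub>L\<^esub> x)),
     bracket = (\<lambda>A B. \<Union>x\<in>A. \<Union>y\<in>B. I +>\<^bsub>L\<^esub> \<lbrakk>x, y\<rbrakk>\<^bsub>L\<^esub>)\<rparr>"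

definition peiffer_ideal ::
  "('r, 'x) ring_scheme \<Rightarrow> ('r, 'm, 'y) lie_algebra_scheme \<Rightarrow> ('r, 'n, 'z) lie_algebra_scheme
    \<Rightarrow> ('m \<Rightarrow> 'n \<Rightarrow> 'n) \<Rightarrow> ('n \<Rightarrow> 'm \<Rightarrow> 'm) \<Rightarrow> ('r, 'm, 'n) lie_term set set" where
  "peiffer_ideal R M N \<alpha> \<beta> =
    (let S = lie_coproduct R M N; iM = coproduct_inM R M N; iN = coproduct_inN R M N in
      gen_lie_ideal R S
        ({iM (\<beta> n m) \<ominus>\<^bsub>S\<^esub> \<lbrakk>iN n, iM m\<rbrakk>\<^bsub>S\<^esub> | m n. m \<in> carrier M \<and> n \<in> carrier N} \<union>
         {iN (\<alpha> m n) \<ominus>\<^bsub>S\<^esub> \<lbrakk>iM m, iN n\<rbrakk>\<^bsub>S\<^esub> | m n. m \<in> carrier M \<and> n \<in> carrier N}))"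

definition peiffer_product ::
  "('r, 'x) ring_scheme \<Rightarrow> ('r, 'm, 'y) lie_algebra_scheme \<Rightarrow> ('r, 'n, 'z) lie_algebra_scheme
    \<Rightarrow> ('m \<Rightarrow> 'n \<Rightarrow> 'n) \<Rightarrow> ('n \<Rightarrow> 'm \<Rightarrow> 'm)
    \<Rightarrow> ('r, ('r, 'm, 'n) lie_term set set) lie_algebra" where
  "peiffer_product R M N \<alpha> \<beta> = lie_quotient (lie_coproduct R M N) (peiffer_ideal R M N \<alpha> \<beta>)"

definition peiffer_quot ::
  "('r, 'x) ring_scheme \<Rightarrow> ('r, 'm, 'y) lie_algebra_scheme \<Rightarrow> ('r, 'n, 'z) lie_algebra_scheme
    \<Rightarrow> ('m \<Rightarrow> 'n \<Rightarrow> 'n) \<Rightarrow> ('n \<Rightarrow> 'm \<Rightarrow> 'm)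
    \<Rightarrow> ('r, 'm, 'n) lie_term set \<Rightarrow> ('r, 'm, 'n) lie_term set set" where
  "peiffer_quot R M N \<alpha> \<beta> s = peiffer_ideal R M N \<alpha> \<beta> +>\<^bsub>lie_coproduct R M N\<^esub> s"


section \<open>Coproduct actions and the induced actions of the Peiffer product\<close>

text \<open>An action is only determined on the carriers, so the definite descriptions range over
  functions that are undefined outside them.

  Given actions \<open>a\<close> of \<open>M\<close> and \<open>b\<close> of \<open>N\<close> on \<open>L\<close>, \<open>coproduct_act R M N L a b\<close> is the unique
  action of \<open>M + N\<close> on \<open>L\<close> that restricts to them.\<close>

definition coproduct_act ::
  "('r, 'x) ring_scheme \<Rightarrow> ('r, 'm, 'y) lie_algebra_scheme \<Rightarrow> ('r, 'n, 'z) lie_algebra_scheme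
    \<Rightarrow> ('r, 'l, 'w) lie_algebra_scheme \<Rightarrow> ('m \<Rightarrow> 'l \<Rightarrow> 'l) \<Rightarrow> ('n \<Rightarrow> 'l \<Rightarrow> 'l)
    \<Rightarrow> ('r, 'm, 'n) lie_term set \<Rightarrow> 'l \<Rightarrow> 'l" where
  "coproduct_act R M N L a b =
    (THE c. lie_action R (lie_coproduct R M N) L c \<and>
      c \<in> carrier (lie_coproduct R M N) \<rightarrow>\<^sub>E (carrier L \<rightarrow>\<^sub>E carrier L) \<and>
      (\<forall>m\<in>carrier M. \<forall>x\<in>carrier L. c (coproduct_inM R M N m) x = a m x) \<and>
      (\<forall>n\<in>carrier N. \<forall>x\<in>carrier L. c (coproduct_inN R M N n) x = b n x))"

text \<open>The action of the Peiffer product on \<open>L\<close> (which will be \<open>M\<close> or \<open>N\<close>) through which a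
  given action \<open>c\<close> of \<open>M + N\<close> on \<open>L\<close> factors.\<close>

definition peiffer_act ::
  "('r, 'x) ring_scheme \<Rightarrow> ('r, 'm, 'y) lie_algebra_scheme \<Rightarrow> ('r, 'n, 'z) lie_algebra_scheme
    \<Rightarrow> ('m \<Rightarrow> 'n \<Rightarrow> 'n) \<Rightarrow> ('n \<Rightarrow> 'm \<Rightarrow> 'm) \<Rightarrow> ('r, 'l, 'w) lie_algebra_scheme
    \<Rightarrow> (('r, 'm, 'n) lie_term set \<Rightarrow> 'l \<Rightarrow> 'l)
    \<Rightarrow> ('r, 'm, 'n) lie_term set set \<Rightarrow> 'l \<Rightarrow> 'l" where
  "peiffer_act R M N \<alpha> \<beta> L c =
    (THE \<xi>. lie_action R (peiffer_product R M N \<alpha> \<beta>) L \<xi> \<and>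
      \<xi> \<in> carrier (peiffer_product R M N \<alpha> \<beta>) \<rightarrow>\<^sub>E (carrier L \<rightarrow>\<^sub>E carrier L) \<and>
      (\<forall>s\<in>carrier (lie_coproduct R M N). \<forall>x\<in>carrier L.
        \<xi> (peiffer_quot R M N \<alpha> \<beta> s) x = c s x))"

definition peiffer_act_M ::
  "('r, 'x) ring_scheme \<Rightarrow> ('r, 'm, 'y) lie_algebra_scheme \<Rightarrow> ('r, 'n, 'z) lie_algebra_scheme
    \<Rightarrow> ('m \<Rightarrow> 'n \<Rightarrow> 'n) \<Rightarrow> ('n \<Rightarrow> 'm \<Rightarrow> 'm)
    \<Rightarrow> ('r, 'm, 'n) lie_term set set \<Rightarrow> 'm \<Rightarrow> 'm" where
  "peiffer_act_M R M N \<alpha> \<beta> =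
    peiffer_act R M N \<alpha> \<beta> M (coproduct_act R M N M (bracket M) \<beta>)"

definition peiffer_act_N ::
  "('r, 'x) ring_scheme \<Rightarrow> ('r, 'm, 'y) lie_algebra_scheme \<Rightarrow> ('r, 'n, 'z) lie_algebra_scheme
    \<Rightarrow> ('m \<Rightarrow> 'n \<Rightarrow> 'n) \<Rightarrow> ('n \<Rightarrow> 'm \<Rightarrow> 'm)
    \<Rightarrow> ('r, 'm, 'n) lie_term set set \<Rightarrow> 'n \<Rightarrow> 'n" where
  "peiffer_act_N R M N \<alpha> \<beta> =
    peiffer_act R M N \<alpha> \<beta> N (coproduct_act R M N N \<alpha> (bracket N))"

end

theory Submission
  imports Defs
begin

text \<open>The kernel of a Lie algebra action is an ideal. By compatibility the generators of the
  Peiffer ideal \<open>K\<close> lie in the kernels of the coproduct actions, so \<open>K\<close> acts trivially and both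
  actions descend to \<open>(M + N) / K\<close>. The Peiffer identity holds because \<open>M\<close> and \<open>N\<close> act on themselves by
  their brackets. Equivariance \<open>l (act p x) = [p, l x]\<close> holds for \<open>p\<close> in the images of \<open>M\<close> and \<open>N\<close> by the
  relations defining \<open>K\<close>, and the elements \<open>p\<close> for which it holds form a subalgebra.\<close>

section \<open>Differences in abelian groups and modules\<close>

context abelian_group
begin

text \<open>Together with \<open>diff_simps\<close> this clears an equation of differences: they are
  pulled outwards and then moved to the other side. What remains is an equation between sums, which
  \<open>a_ac\<close> decides.\<close>

lemma diff_eq_iff:
  assumes "a \<in> carrier G" "b \<in> carrier G" "c \<in> carrier G"
  shows "a \<ominus> b = c \<longleftrightarrow> a = c \<oplus> b" "c = a \<ominus> b \<longleftrightarrow> c \<oplus> b = a"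
  using assms by (auto simp: minus_eq a_assoc l_neg r_neg)

lemma diff_simps:
  assumes "a \<in> carrier G" "b \<in> carrier G" "c \<in> carrier G"
  shows "a \<ominus> b \<oplus> c = a \<oplus> c \<ominus> b"
    and "c \<oplus> (a \<ominus> b) = c \<oplus> a \<ominus> b"
    and "a \<ominus> b \<ominus> c = a \<ominus> (b \<oplus> c)"
    and "a \<ominus> (b \<ominus> c) = a \<oplus> c \<ominus> b"
  using assms by (simp_all add: minus_eq minus_add a_ac)

end

context module
begin

lemma smult_diff:
  "r \<in> carrier R \<Longrightarrow> x \<in> carrier M \<Longrightarrow> y \<in> carrier M \<Longrightarrow>
    r \<odot>\<^bsub>M\<^esub> (x \<ominus>\<^bsub>M\<^esub> y) = r \<odot>\<^bsub>M\<^esub> x \<ominus>\<^bsub>M\<^esub> r \<odot>\<^bsub>M\<^esub> y"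
  by (simp add: M.minus_eq smult_r_distr smult_r_minus)

lemma smult_left_comm:
  "r \<in> carrier R \<Longrightarrow> r' \<in> carrier R \<Longrightarrow> x \<in> carrier M \<Longrightarrow>
    r \<odot>\<^bsub>M\<^esub> (r' \<odot>\<^bsub>M\<^esub> x) = r' \<odot>\<^bsub>M\<^esub> (r \<odot>\<^bsub>M\<^esub> x)"
  by (metis smult_assoc1 R.m_comm)

end

section \<open>Consequences of the Lie algebra axioms\<close>

context lie_algebra
begin

lemma bracket_zero_left [simp]:
  assumes "x \<in> carrier L" shows "\<lbrakk>\<zero>\<^bsub>L\<^esub>, x\<rbrakk>\<^bsub>L\<^esub> = \<zero>\<^bsub>L\<^esub>"
  using bracket_smult_left[OF R.zero_closed M.zero_closed assms] assms by simp

lemma bracket_zero_right [simp]: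
  assumes "x \<in> carrier L" shows "\<lbrakk>x, \<zero>\<^bsub>L\<^esub>\<rbrakk>\<^bsub>L\<^esub> = \<zero>\<^bsub>L\<^esub>"
  using bracket_smult_right[OF R.zero_closed assms M.zero_closed] assms by simp

lemma bracket_anti:
  assumes "x \<in> carrier L" "y \<in> carrier L"
  shows "\<lbrakk>y, x\<rbrakk>\<^bsub>L\<^esub> = \<ominus>\<^bsub>L\<^esub> \<lbrakk>x, y\<rbrakk>\<^bsub>L\<^esub>"
proof -
  have "\<zero>\<^bsub>L\<^esub> = \<lbrakk>x \<oplus>\<^bsub>L\<^esub> y, x \<oplus>\<^bsub>L\<^esub> y\<rbrakk>\<^bsub>L\<^esub>"
    using assms by (simp add: bracket_self)
  also have "\<dots> = \<lbrakk>x, x\<rbrakk>\<^bsub>L\<^esub> \<oplus>\<^bsub>L\<^esub> \<lbrakk>y, x\<rbrakk>\<^bsub>L\<^esub> \<oplus>\<^bsub>L\<^esub> (\<lbrakk>x, y\<rbrakk>\<^bsub>L\<^esub> \<oplus>\<^bsub>L\<^esub> \<lbrakk>y, y\<rbrakk>\<^bsub>L\<^esub>)"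
    using assms by (simp add: bracket_add_left bracket_add_right)
  also have "\<dots> = \<lbrakk>y, x\<rbrakk>\<^bsub>L\<^esub> \<oplus>\<^bsub>L\<^esub> \<lbrakk>x, y\<rbrakk>\<^bsub>L\<^esub>"
    using assms by (simp add: bracket_self)
  finally show ?thesis
    using assms by (simp add: M.minus_equality)
qed

lemma bracket_minus_right:
  assumes "x \<in> carrier L" "y \<in> carrier L"
  shows "\<lbrakk>x, \<ominus>\<^bsub>L\<^esub> y\<rbrakk>\<^bsub>L\<^esub> = \<ominus>\<^bsub>L\<^esub> \<lbrakk>x, y\<rbrakk>\<^bsub>L\<^esub>"
  using bracket_smult_right[of "\<ominus>\<^bsub>R\<^esub> \<one>\<^bsub>R\<^esub>" x y] assms by (simp add: smult_l_minus)

lemma bracket_minus_left: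
  assumes "x \<in> carrier L" "y \<in> carrier L"
  shows "\<lbrakk>\<ominus>\<^bsub>L\<^esub> x, y\<rbrakk>\<^bsub>L\<^esub> = \<ominus>\<^bsub>L\<^esub> \<lbrakk>x, y\<rbrakk>\<^bsub>L\<^esub>"
  using bracket_smult_left[of "\<ominus>\<^bsub>R\<^esub> \<one>\<^bsub>R\<^esub>" x y] assms by (simp add: smult_l_minus)

lemma bracket_diff_left:
  "x \<in> carrier L \<Longrightarrow> y \<in> carrier L \<Longrightarrow> z \<in> carrier L \<Longrightarrow>
    \<lbrakk>x \<ominus>\<^bsub>L\<^esub> y, z\<rbrakk>\<^bsub>L\<^esub> = \<lbrakk>x, z\<rbrakk>\<^bsub>L\<^esub> \<ominus>\<^bsub>L\<^esub> \<lbrakk>y, z\<rbrakk>\<^bsub>L\<^esub>"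
  by (simp add: M.minus_eq bracket_add_left bracket_minus_left)

lemma bracket_diff_right:
  "x \<in> carrier L \<Longrightarrow> y \<in> carrier L \<Longrightarrow> z \<in> carrier L \<Longrightarrow>
    \<lbrakk>z, x \<ominus>\<^bsub>L\<^esub> y\<rbrakk>\<^bsub>L\<^esub> = \<lbrakk>z, x\<rbrakk>\<^bsub>L\<^esub> \<ominus>\<^bsub>L\<^esub> \<lbrakk>z, y\<rbrakk>\<^bsub>L\<^esub>"
  by (simp add: M.minus_eq bracket_add_right bracket_minus_right)

text \<open>The Jacobi identity in the form ad [x, y] = ad x ad y - ad y ad x, which is the law
  \<open>act_bracket_left\<close> for the adjoint action. Antisymmetry is applied to the outer
  bracket of one summand of \<open>jacobi\<close> and to the inner bracket of another.\<close>

lemma bracket_bracket_left: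
  assumes "x \<in> carrier L" "y \<in> carrier L" "z \<in> carrier L"
  shows "\<lbrakk>\<lbrakk>x, y\<rbrakk>\<^bsub>L\<^esub>, z\<rbrakk>\<^bsub>L\<^esub> = \<lbrakk>x, \<lbrakk>y, z\<rbrakk>\<^bsub>L\<^esub>\<rbrakk>\<^bsub>L\<^esub> \<ominus>\<^bsub>L\<^esub> \<lbrakk>y, \<lbrakk>x, z\<rbrakk>\<^bsub>L\<^esub>\<rbrakk>\<^bsub>L\<^esub>"
proof -
  have "\<lbrakk>z, \<lbrakk>x, y\<rbrakk>\<^bsub>L\<^esub>\<rbrakk>\<^bsub>L\<^esub> = \<ominus>\<^bsub>L\<^esub> \<lbrakk>\<lbrakk>x, y\<rbrakk>\<^bsub>L\<^esub>, z\<rbrakk>\<^bsub>L\<^esub>"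
    "\<lbrakk>y, \<lbrakk>z, x\<rbrakk>\<^bsub>L\<^esub>\<rbrakk>\<^bsub>L\<^esub> = \<ominus>\<^bsub>L\<^esub> \<lbrakk>y, \<lbrakk>x, z\<rbrakk>\<^bsub>L\<^esub>\<rbrakk>\<^bsub>L\<^esub>"
    using assms bracket_anti[of x z] by (auto intro: bracket_anti simp: bracket_minus_right)
  then show ?thesis
    using jacobi[OF assms] assms
    by (simp add: M.minus_eq[symmetric] M.diff_simps M.diff_eq_iff M.a_comm)
qed

text \<open>The adjoint action. Both bracket laws of an action are here the identity
  \<open>bracket_bracket_left\<close>, solved for different terms.\<close>

lemma lie_action_bracket: "lie_action R L L (bracket L)"
  by (intro lie_action.intro lie_action_axioms.intro lie_algebra_axioms)
    (auto simp: bracket_add_left bracket_add_right bracket_smult_left bracket_smult_right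
      bracket_bracket_left M.diff_simps M.diff_eq_iff M.a_ac)

end

section \<open>Elementary properties of actions and the annihilator\<close>

context lie_action
begin

lemma act_zero_left [simp]: "m \<in> carrier M \<Longrightarrow> act \<zero>\<^bsub>P\<^esub> m = \<zero>\<^bsub>M\<^esub>"
  using act_smult_left[of "\<zero>\<^bsub>R\<^esub>" "\<zero>\<^bsub>P\<^esub>" m] by (simp add: act_closed)

lemma act_zero_right [simp]: "p \<in> carrier P \<Longrightarrow> act p \<zero>\<^bsub>M\<^esub> = \<zero>\<^bsub>M\<^esub>"
  using act_smult_right[of "\<zero>\<^bsub>R\<^esub>" p "\<zero>\<^bsub>M\<^esub>"] by (simp add: act_closed)

lemma act_minus_left: "p \<in> carrier P \<Longrightarrow> m \<in> carrier M \<Longrightarrow> act (\<ominus>\<^bsub>P\<^esub> p) m = \<ominus>\<^bsub>M\<^esub> act p m"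
  using act_smult_left[of "\<ominus>\<^bsub>R\<^esub> \<one>\<^bsub>R\<^esub>" p m] by (simp add: act_closed P.smult_l_minus M.smult_l_minus)

text \<open>If p annihilates M, then [x, p] sends m to x(pm) - p(xm): the first term is x applied to
  zero, and the second vanishes because xm lies in M again. Being an ideal, the annihilator contains
  a generated ideal as soon as it contains the generators.\<close>

lemma lie_ideal_annihilator:
  "lie_ideal R P {p \<in> carrier P. \<forall>m\<in>carrier M. act p m = \<zero>\<^bsub>M\<^esub>}"
  unfolding lie_ideal_def
  by (intro conjI P.submoduleI)
    (auto simp: act_closed act_add_left act_minus_left act_smult_left act_bracket_left M.minus_eq)

end

section \<open>Ideals, cosets and quotient Lie algebras\<close>

context lie_algebra
begin

lemma abelian_subgroup_lie_ideal: "lie_ideal R L I \<Longrightarrow> abelian_subgroup I L"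
  unfolding lie_ideal_def
  by (auto intro: abelian_subgroupI3 additive_subgroupI M.abelian_group_axioms submodule.axioms)

context
  fixes I
  assumes I: "lie_ideal R L I"
begin

interpretation I: abelian_subgroup I L
  using I by (rule abelian_subgroup_lie_ideal)

lemma lie_ideal_smult: "r \<in> carrier R \<Longrightarrow> i \<in> I \<Longrightarrow> r \<odot>\<^bsub>L\<^esub> i \<in> I"
  using I by (auto simp: lie_ideal_def intro: submodule.smult_closed)

lemma lie_ideal_bracket:
  "x \<in> carrier L \<Longrightarrow> i \<in> I \<Longrightarrow> \<lbrakk>x, i\<rbrakk>\<^bsub>L\<^esub> \<in> I"
  "x \<in> carrier L \<Longrightarrow> i \<in> I \<Longrightarrow> \<lbrakk>i, x\<rbrakk>\<^bsub>L\<^esub> \<in> I"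
  using I by (auto simp: lie_ideal_def)

lemma mem_coset_iff: "y \<in> I +>\<^bsub>L\<^esub> x \<longleftrightarrow> (\<exists>i\<in>I. y = i \<oplus>\<^bsub>L\<^esub> x)"
  by (auto simp: a_r_coset_def')

lemma coset_nonempty: "x \<in> carrier L \<Longrightarrow> I +>\<^bsub>L\<^esub> x \<noteq> {}"
  using I.a_rcos_self by blast

text \<open>Representatives of one coset differ by a summand from the ideal. In this form
  simplification removes that summand, which is how the operations on cosets are seen to be well
  defined.\<close>

lemma coset_add_ideal:
  assumes "i \<in> I" "x \<in> carrier L"
  shows "I +>\<^bsub>L\<^esub> (i \<oplus>\<^bsub>L\<^esub> x) = I +>\<^bsub>L\<^esub> x"
  using I.a_repr_independence'[of "i \<oplus>\<^bsub>L\<^esub> x" x] assms by (auto simp: mem_coset_iff)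

lemma coset_eqI:
  assumes "x \<in> carrier L" "y \<in> carrier L" "x \<ominus>\<^bsub>L\<^esub> y \<in> I"
  shows "I +>\<^bsub>L\<^esub> x = I +>\<^bsub>L\<^esub> y"
  using coset_add_ideal[OF assms(3,2)] assms(1,2) by (simp add: M.minus_eq M.a_assoc M.l_neg)

lemma lie_quotient_carrier: "carrier (lie_quotient L I) = (\<lambda>x. I +>\<^bsub>L\<^esub> x) ` carrier L"
  by (auto simp: lie_quotient_def A_RCOSETS_def')

lemma lie_quotient_zero: "\<zero>\<^bsub>lie_quotient L I\<^esub> = I +>\<^bsub>L\<^esub> \<zero>\<^bsub>L\<^esub>"
  by (simp add: lie_quotient_def I.a_rcos_const)

lemma lie_quotient_add:
  "x \<in> carrier L \<Longrightarrow> y \<in> carrier L \<Longrightarrow>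
    (I +>\<^bsub>L\<^esub> x) \<oplus>\<^bsub>lie_quotient L I\<^esub> (I +>\<^bsub>L\<^esub> y) = I +>\<^bsub>L\<^esub> (x \<oplus>\<^bsub>L\<^esub> y)"
  by (simp add: lie_quotient_def I.a_rcos_sum)

lemma lie_quotient_smult:
  assumes "r \<in> carrier R" "x \<in> carrier L"
  shows "r \<odot>\<^bsub>lie_quotient L I\<^esub> (I +>\<^bsub>L\<^esub> x) = I +>\<^bsub>L\<^esub> (r \<odot>\<^bsub>L\<^esub> x)"
proof -
  \<comment> \<open>The quotient operation is a union over all representatives. Its members are all
    the same coset, because multiples of elements of \<open>I\<close> stay in
    \<open>I\<close>.\<close>
  have "I +>\<^bsub>L\<^esub> (r \<odot>\<^bsub>L\<^esub> x') = I +>\<^bsub>L\<^esub> (r \<odot>\<^bsub>L\<^esub> x)" if "x' \<in> I +>\<^bsub>L\<^esub> x" for x'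
    using that assms by (auto simp: mem_coset_iff smult_r_distr coset_add_ideal lie_ideal_smult)
  then show ?thesis
    using assms by (simp add: lie_quotient_def coset_nonempty)
qed

lemma lie_quotient_bracket:
  assumes "x \<in> carrier L" "y \<in> carrier L"
  shows "\<lbrakk>I +>\<^bsub>L\<^esub> x, I +>\<^bsub>L\<^esub> y\<rbrakk>\<^bsub>lie_quotient L I\<^esub> = I +>\<^bsub>L\<^esub> \<lbrakk>x, y\<rbrakk>\<^bsub>L\<^esub>"
proof -
  have "I +>\<^bsub>L\<^esub> \<lbrakk>x', y'\<rbrakk>\<^bsub>L\<^esub> = I +>\<^bsub>L\<^esub> \<lbrakk>x, y\<rbrakk>\<^bsub>L\<^esub>" if xy': "x' \<in> I +>\<^bsub>L\<^esub> x" "y' \<in> I +>\<^bsub>L\<^esub> y" for x' y'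
  proof -
    obtain i j where ij: "i \<in> I" "j \<in> I" "x' = i \<oplus>\<^bsub>L\<^esub> x" "y' = j \<oplus>\<^bsub>L\<^esub> y"
      using xy' by (auto simp: mem_coset_iff)
    \<comment> \<open>Every summand except [x, y] has an entry in \<open>I\<close>. The bracket with
      i is left unexpanded, since it lies in \<open>I\<close> as a whole.\<close>
    then have "\<lbrakk>x', y'\<rbrakk>\<^bsub>L\<^esub> = \<lbrakk>i, j \<oplus>\<^bsub>L\<^esub> y\<rbrakk>\<^bsub>L\<^esub> \<oplus>\<^bsub>L\<^esub> (\<lbrakk>x, j\<rbrakk>\<^bsub>L\<^esub> \<oplus>\<^bsub>L\<^esub> \<lbrakk>x, y\<rbrakk>\<^bsub>L\<^esub>)"
      using assms by (simp add: bracket_add_left bracket_add_right M.a_ac)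
    then show ?thesis
      using ij assms by (simp add: coset_add_ideal lie_ideal_bracket)
  qed
  then have "(\<Union>y'\<in>I +>\<^bsub>L\<^esub> y. I +>\<^bsub>L\<^esub> \<lbrakk>x', y'\<rbrakk>\<^bsub>L\<^esub>) = I +>\<^bsub>L\<^esub> \<lbrakk>x, y\<rbrakk>\<^bsub>L\<^esub>" if "x' \<in> I +>\<^bsub>L\<^esub> x" for x'
    using that by (intro UN_constant_eq[OF I.a_rcos_self[OF assms(2)]]) simp
  then show ?thesis
    using assms by (simp add: lie_quotient_def coset_nonempty)
qed

lemmas lie_quotient_simps = lie_quotient_carrier lie_quotient_zero lie_quotient_add
  lie_quotient_smult lie_quotient_bracket

lemma lie_algebra_quotient: "lie_algebra R (lie_quotient L I)"
proof -
  note [simp] = lie_quotient_simps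
  have ag: "abelian_group (lie_quotient L I)"
  proof (rule abelian_groupI)
    fix X assume "X \<in> carrier (lie_quotient L I)"
    then obtain x where "x \<in> carrier L" "X = I +>\<^bsub>L\<^esub> x" by auto
    then show "\<exists>Y\<in>carrier (lie_quotient L I). Y \<oplus>\<^bsub>lie_quotient L I\<^esub> X = \<zero>\<^bsub>lie_quotient L I\<^esub>"
      by (intro bexI[of _ "I +>\<^bsub>L\<^esub> (\<ominus>\<^bsub>L\<^esub> x)"]) (auto simp: M.l_neg)
  qed (auto simp: M.a_ac)
  have mod: "module R (lie_quotient L I)"
    by (rule moduleI[OF R.is_cring ag]) (auto simp: smult_l_distr smult_r_distr smult_assoc1)
  show ?thesis
    by (rule lie_algebra.intro[OF mod], rule lie_algebra_axioms.intro)
      (auto simp: bracket_add_left bracket_add_right bracket_smult_left bracket_smult_right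
        bracket_self jacobi)
qed

lemma coset_lie_hom: "a_r_coset L I \<in> lie_hom R L (lie_quotient L I)"
  by (auto simp: lie_hom_def lie_quotient_simps)

end

text \<open>Puts the whole algebra into the family intersected in \<open>gen_lie_ideal\<close>, so
  that the ideal generated by a subset of the carrier stays inside the carrier.\<close>

lemma lie_ideal_carrier: "lie_ideal R L (carrier L)"
  unfolding lie_ideal_def by (auto intro: carrier_is_submodule)

lemma lie_ideal_gen_lie_ideal:
  assumes "S \<subseteq> carrier L"
  shows "lie_ideal R L (gen_lie_ideal R L S)"
proof -
  have *: "I \<subseteq> carrier L" "\<zero>\<^bsub>L\<^esub> \<in> I" "i \<in> I \<Longrightarrow> \<ominus>\<^bsub>L\<^esub> i \<in> I" "i \<in> I \<Longrightarrow> j \<in> I \<Longrightarrow> i \<oplus>\<^bsub>L\<^esub> j \<in> I"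
    if "lie_ideal R L I" for I i j
  proof -
    interpret I: abelian_subgroup I L using that by (rule abelian_subgroup_lie_ideal)
    show "I \<subseteq> carrier L" "\<zero>\<^bsub>L\<^esub> \<in> I" "i \<in> I \<Longrightarrow> \<ominus>\<^bsub>L\<^esub> i \<in> I" "i \<in> I \<Longrightarrow> j \<in> I \<Longrightarrow> i \<oplus>\<^bsub>L\<^esub> j \<in> I"
      by (use I.a_subset in auto)
  qed
  show ?thesis
    unfolding lie_ideal_def
  proof (intro conjI submoduleI)
    show "gen_lie_ideal R L S \<subseteq> carrier L"
      using lie_ideal_carrier assms unfolding gen_lie_ideal_def by blast
    show "\<forall>x\<in>carrier L. \<forall>i\<in>gen_lie_ideal R L S.
        \<lbrakk>x, i\<rbrakk>\<^bsub>L\<^esub> \<in> gen_lie_ideal R L S \<and> \<lbrakk>i, x\<rbrakk>\<^bsub>L\<^esub> \<in> gen_lie_ideal R L S"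
      unfolding gen_lie_ideal_def by (auto simp: lie_ideal_def)
  qed (use * in \<open>auto simp: gen_lie_ideal_def lie_ideal_smult\<close>)
qed

end

section \<open>Morphisms, and actions of quotients\<close>

lemma lie_hom_zero:
  assumes "lie_algebra R L" "lie_algebra R L'" "f \<in> lie_hom R L L'"
  shows "f \<zero>\<^bsub>L\<^esub> = \<zero>\<^bsub>L'\<^esub>"
proof -
  interpret L: lie_algebra R L by fact
  interpret L': lie_algebra R L' by fact
  \<comment> \<open>The zero of \<open>L\<close> is the scalar zero times itself, so linearity turns
    its image into a zero multiple.\<close>
  have f: "f \<zero>\<^bsub>L\<^esub> \<in> carrier L'" "f (\<zero>\<^bsub>R\<^esub> \<odot>\<^bsub>L\<^esub> \<zero>\<^bsub>L\<^esub>) = \<zero>\<^bsub>R\<^esub> \<odot>\<^bsub>L'\<^esub> f \<zero>\<^bsub>L\<^esub>"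
    using assms(3) L.M.zero_closed L.R.zero_closed unfolding lie_hom_def by blast+
  then show ?thesis by simp
qed

lemma lie_hom_diff:
  assumes "lie_algebra R L" "lie_algebra R L'" "f \<in> lie_hom R L L'" "x \<in> carrier L" "y \<in> carrier L"
  shows "f (x \<ominus>\<^bsub>L\<^esub> y) = f x \<ominus>\<^bsub>L'\<^esub> f y"
proof -
  interpret L: lie_algebra R L by fact
  interpret L': lie_algebra R L' by fact
  have "f (x \<ominus>\<^bsub>L\<^esub> y) \<oplus>\<^bsub>L'\<^esub> f y = f (x \<ominus>\<^bsub>L\<^esub> y \<oplus>\<^bsub>L\<^esub> y)"
    using assms(3-5) by (simp add: lie_hom_def)
  also have "x \<ominus>\<^bsub>L\<^esub> y \<oplus>\<^bsub>L\<^esub> y = x"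
    using assms(4,5) by (simp add: L.M.minus_eq L.M.a_assoc L.M.l_neg)
  finally show ?thesis
    using assms(3-5) by (subst L'.M.diff_eq_iff) (auto simp: lie_hom_def)
qed

lemma lie_hom_comp:
  "f \<in> lie_hom R L L' \<Longrightarrow> g \<in> lie_hom R L' L'' \<Longrightarrow> g \<circ> f \<in> lie_hom R L L''"
  by (auto simp: lie_hom_def Pi_def)

text \<open>A coset acts through any of its representatives: two of them differ by an element of
  \<open>I\<close>, which acts as zero. Uniqueness holds because every element of the quotient is a
  coset of some p and the functions are fixed outside the carriers. The statement has the shape of
  the definite description in \<open>peiffer_act\<close>.\<close>

lemma (in lie_action) ex1_quotient_action:
  assumes I: "lie_ideal R P I"
    and trivial: "\<And>i m. i \<in> I \<Longrightarrow> m \<in> carrier M \<Longrightarrow> act i m = \<zero>\<^bsub>M\<^esub>"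
  shows "\<exists>!\<xi>. lie_action R (lie_quotient P I) M \<xi> \<and>
    \<xi> \<in> carrier (lie_quotient P I) \<rightarrow>\<^sub>E (carrier M \<rightarrow>\<^sub>E carrier M) \<and>
    (\<forall>p\<in>carrier P. \<forall>m\<in>carrier M. \<xi> (I +>\<^bsub>P\<^esub> p) m = act p m)"
proof -
  interpret I: abelian_subgroup I P
    using I by (rule P.abelian_subgroup_lie_ideal)
  note simps = P.lie_quotient_simps[OF I]
  \<comment> \<open>\<open>SOME\<close> picks a representative, and the restricted lambdas supply
    \<open>undefined\<close> outside the carriers, as extensionality demands.\<close>
  define \<xi> where "\<xi> = (\<lambda>X\<in>carrier (lie_quotient P I). \<lambda>m\<in>carrier M. act (SOME p. p \<in> X) m)"
  have \<xi>: "\<xi> (I +>\<^bsub>P\<^esub> p) m = act p m" if "p \<in> carrier P" "m \<in> carrier M" for p m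
  proof -
    have "(SOME q. q \<in> I +>\<^bsub>P\<^esub> p) \<in> I +>\<^bsub>P\<^esub> p"
      using I.a_rcos_self[OF that(1)] by (rule someI)
    then obtain i where "i \<in> I" "(SOME q. q \<in> I +>\<^bsub>P\<^esub> p) = i \<oplus>\<^bsub>P\<^esub> p"
      by (auto simp: P.mem_coset_iff[OF I])
    then show ?thesis
      using that by (simp add: \<xi>_def simps trivial act_add_left act_closed)
  qed
  show ?thesis
  proof (rule ex1I[of _ \<xi>], intro conjI)
    show "lie_action R (lie_quotient P I) M \<xi>"
      by (intro lie_action.intro lie_action_axioms.intro P.lie_algebra_quotient I
          M.lie_algebra_axioms)
        (auto simp: simps \<xi> act_closed act_add_left act_add_right act_smult_left
          act_smult_right act_bracket_left act_bracket_right)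
    show "\<xi> \<in> carrier (lie_quotient P I) \<rightarrow>\<^sub>E (carrier M \<rightarrow>\<^sub>E carrier M)"
      by (rule PiE_I, rule PiE_I) (auto simp: simps \<xi> act_closed, auto simp: \<xi>_def simps)
    show "\<forall>p\<in>carrier P. \<forall>m\<in>carrier M. \<xi> (I +>\<^bsub>P\<^esub> p) m = act p m"
      by (simp add: \<xi>)
  next
    fix \<eta>
    assume \<eta>: "lie_action R (lie_quotient P I) M \<eta> \<and>
      \<eta> \<in> carrier (lie_quotient P I) \<rightarrow>\<^sub>E (carrier M \<rightarrow>\<^sub>E carrier M) \<and>
      (\<forall>p\<in>carrier P. \<forall>m\<in>carrier M. \<eta> (I +>\<^bsub>P\<^esub> p) m = act p m)"
    show "\<eta> = \<xi>"
    proof (rule extensionalityI[of _ "carrier (lie_quotient P I)"])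
      fix X assume X: "X \<in> carrier (lie_quotient P I)"
      show "\<eta> X = \<xi> X"
        by (rule extensionalityI[of _ "carrier M"])
          (use X \<eta> in \<open>auto simp: simps \<xi> PiE_iff Pi_iff\<close>, simp add: \<xi>_def simps)
    qed (use \<eta> in \<open>auto simp: PiE_iff \<xi>_def\<close>)
  qed
qed

section \<open>Induction over the coproduct, and its actions\<close>

text \<open>The images of M and N generate the coproduct: its elements are classes of terms, so
  structural induction on terms carries over. It serves to prove uniqueness of the coproduct action
  and equivariance of the boundary maps.\<close>

lemma coproduct_induct [consumes 3, case_names inM inN zero add smult bracket]:
  assumes "lie_algebra R M" "lie_algebra R N" and "s \<in> carrier (lie_coproduct R M N)"
    and "\<And>m. m \<in> carrier M \<Longrightarrow> Q (coproduct_inM R M N m)"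
    and "\<And>n. n \<in> carrier N \<Longrightarrow> Q (coproduct_inN R M N n)"
    and "Q \<zero>\<^bsub>lie_coproduct R M N\<^esub>"
    and "\<And>s t. \<lbrakk>s \<in> carrier (lie_coproduct R M N); Q s; t \<in> carrier (lie_coproduct R M N); Q t\<rbrakk>
      \<Longrightarrow> Q (s \<oplus>\<^bsub>lie_coproduct R M N\<^esub> t)"
    and "\<And>r s. \<lbrakk>r \<in> carrier R; s \<in> carrier (lie_coproduct R M N); Q s\<rbrakk>
      \<Longrightarrow> Q (r \<odot>\<^bsub>lie_coproduct R M N\<^esub> s)"
    and "\<And>s t. \<lbrakk>s \<in> carrier (lie_coproduct R M N); Q s; t \<in> carrier (lie_coproduct R M N); Q t\<rbrakk>
      \<Longrightarrow> Q \<lbrakk>s, t\<rbrakk>\<^bsub>lie_coproduct R M N\<^esub>"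
  shows "Q s"
proof -
  note MN = assms(1,2)
  have "Q (lie_class R M N t)" if "t \<in> lie_terms R M N" for t
    using that
  proof induction
    case (InM m) then show ?case using assms(4) by (simp add: coproduct_inM_def)
  next
    case (InN n) then show ?case using assms(5) by (simp add: coproduct_inN_def)
  next
    case Zero then show ?case using assms(6) by (simp add: coproduct_zero[OF MN])
  next
    case (Add s t) then show ?case
      using assms(7) by (metis coproduct_add[OF MN] coproduct_carrier[OF MN] imageI)
  next
    case (Smult r t) then show ?case
      using assms(8) by (metis coproduct_smult[OF MN] coproduct_carrier[OF MN] imageI)
  next
    case (Bracket s t) then show ?case
      using assms(9) by (metis coproduct_bracket[OF MN] coproduct_carrier[OF MN] imageI)
  qed
  then show ?thesis
    using assms(3) by (auto simp: coproduct_carrier[OF MN])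
qed

text \<open>The congruence rules of \<open>lie_eqv\<close> do not list membership in
  \<open>lie_terms\<close> among their premises. It is recovered here so that, in the bracket case
  of \<open>term_act_eqv\<close>, inner values are known to lie in \<open>carrier L\<close>.\<close>

lemma lie_eqv_terms:
  assumes "lie_algebra R M" "lie_algebra R N" "lie_eqv R M N s t"
  shows "s \<in> lie_terms R M N \<and> t \<in> lie_terms R M N"
proof -
  interpret M: lie_algebra R M by fact
  interpret N: lie_algebra R N by fact
  show ?thesis
    using assms(3) by induction (auto intro: lie_terms.intros)
qed

text \<open>Acting by terms avoids constructing the Lie algebra of derivations of \<open>L\<close>, to which one would
  otherwise apply the universal property of the coproduct.\<close>

fun term_act ::
  "('r, 'l, 'w) lie_algebra_scheme \<Rightarrow> ('m \<Rightarrow> 'l \<Rightarrow> 'l) \<Rightarrow> ('n \<Rightarrow> 'l \<Rightarrow> 'l)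
    \<Rightarrow> ('r, 'm, 'n) lie_term \<Rightarrow> 'l \<Rightarrow> 'l"
  where
  "term_act L a b (InM m) x = a m x"
| "term_act L a b (InN n) x = b n x"
| "term_act L a b Zero x = \<zero>\<^bsub>L\<^esub>"
| "term_act L a b (Add s t) x = term_act L a b s x \<oplus>\<^bsub>L\<^esub> term_act L a b t x"
| "term_act L a b (Smult r t) x = r \<odot>\<^bsub>L\<^esub> term_act L a b t x"
| "term_act L a b (Bracket s t) x =
    term_act L a b s (term_act L a b t x) \<ominus>\<^bsub>L\<^esub> term_act L a b t (term_act L a b s x)"

text \<open>Both coproduct actions are instances: \<open>L\<close> is M with its bracket and
  \<open>\<beta>\<close>, or N with \<open>\<alpha>\<close> and its bracket.\<close>

locale lie_action_pair =
  A: lie_action R M L a + B: lie_action R N L b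
  for R :: "('r, 'x) ring_scheme" (structure)
    and M :: "('r, 'm, 'y) lie_algebra_scheme"
    and N :: "('r, 'n, 'z) lie_algebra_scheme"
    and L :: "('r, 'l, 'w) lie_algebra_scheme"
    and a :: "'m \<Rightarrow> 'l \<Rightarrow> 'l"
    and b :: "'n \<Rightarrow> 'l \<Rightarrow> 'l"
begin

lemmas MN = A.P.lie_algebra_axioms B.P.lie_algebra_axioms

abbreviation "\<tau> \<equiv> term_act L a b"

lemma term_act_closed: "t \<in> lie_terms R M N \<Longrightarrow> x \<in> carrier L \<Longrightarrow> \<tau> t x \<in> carrier L"
  by (induction arbitrary: x rule: lie_terms.induct) (auto simp: A.act_closed B.act_closed)

lemma term_act_add:
  "t \<in> lie_terms R M N \<Longrightarrow> x \<in> carrier L \<Longrightarrow> y \<in> carrier L \<Longrightarrow>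
    \<tau> t (x \<oplus>\<^bsub>L\<^esub> y) = \<tau> t x \<oplus>\<^bsub>L\<^esub> \<tau> t y"
  by (induction arbitrary: x y rule: lie_terms.induct)
    (simp_all add: term_act_closed A.act_add_right B.act_add_right A.M.smult_r_distr
      A.M.M.diff_simps A.M.M.diff_eq_iff A.M.M.a_ac)

lemma term_act_smult:
  "t \<in> lie_terms R M N \<Longrightarrow> r \<in> carrier R \<Longrightarrow> x \<in> carrier L \<Longrightarrow>
    \<tau> t (r \<odot>\<^bsub>L\<^esub> x) = r \<odot>\<^bsub>L\<^esub> \<tau> t x"
  by (induction arbitrary: x rule: lie_terms.induct)
    (auto simp: term_act_closed A.act_smult_right B.act_smult_right A.M.smult_r_distr
      A.M.smult_diff A.M.smult_left_comm)

lemma term_act_diff: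
  assumes "t \<in> lie_terms R M N" "x \<in> carrier L" "y \<in> carrier L"
  shows "\<tau> t (x \<ominus>\<^bsub>L\<^esub> y) = \<tau> t x \<ominus>\<^bsub>L\<^esub> \<tau> t y"
  using assms term_act_add[of t "x \<ominus>\<^bsub>L\<^esub> y" y]
  by (simp add: term_act_closed A.M.M.diff_eq_iff A.M.M.minus_eq A.M.M.a_assoc A.M.M.l_neg A.M.M.r_neg)

text \<open>Every term acts as a derivation. The generators do so by the action laws, and
  derivations are closed under sums, scalar multiples and commutators; in a commutator the mixed
  terms such as [sx, ty] cancel.\<close>

lemma term_act_bracket:
  "t \<in> lie_terms R M N \<Longrightarrow> x \<in> carrier L \<Longrightarrow> y \<in> carrier L \<Longrightarrow>
    \<tau> t \<lbrakk>x, y\<rbrakk>\<^bsub>L\<^esub> = \<lbrakk>\<tau> t x, y\<rbrakk>\<^bsub>L\<^esub> \<oplus>\<^bsub>L\<^esub> \<lbrakk>x, \<tau> t y\<rbrakk>\<^bsub>L\<^esub>"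
proof (induction arbitrary: x y rule: lie_terms.induct)
  case (Add s t)
  then show ?case
    by (simp add: term_act_closed A.M.bracket_add_left A.M.bracket_add_right A.M.M.a_ac)
next
  case (Bracket s t)
  then show ?case
    by (simp add: term_act_closed term_act_add A.M.bracket_diff_left A.M.bracket_diff_right
      A.M.M.diff_simps A.M.M.diff_eq_iff A.M.M.a_ac)
qed (auto simp: term_act_closed A.act_bracket_right B.act_bracket_right A.M.smult_r_distr
    A.M.bracket_smult_left A.M.bracket_smult_right)

text \<open>Linear endomorphisms with the commutator satisfy the Lie algebra axioms, and the
  relations for \<open>InM\<close> and \<open>InN\<close> are the laws of \<open>a\<close> and
  \<open>b\<close> in their first argument. The point x is arbitrary in the induction because
  commutators apply terms to values of other terms.\<close>

lemma term_act_eqv: "lie_eqv R M N s t \<Longrightarrow> x \<in> carrier L \<Longrightarrow> \<tau> s x = \<tau> t x"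
proof (induction arbitrary: x rule: lie_eqv.induct)
  case (cong_add s s' t t')
  then show ?case by simp
next
  case (cong_bracket s s' t t')
  then show ?case
    using cong_bracket.hyps[THEN lie_eqv_terms[OF MN]]
    by (simp add: term_act_closed)
next
  case (jacobi s t u)
  then show ?case
    by (simp add: term_act_closed term_act_diff A.M.M.diff_simps A.M.M.diff_eq_iff A.M.M.a_ac)
next
  case (bracket_self t)
  then show ?case by (simp add: term_act_closed A.M.M.minus_eq A.M.M.r_neg)
qed (auto simp: term_act_closed term_act_add term_act_smult A.act_add_left B.act_add_left
    A.act_smult_left B.act_smult_left A.act_bracket_left B.act_bracket_left
    A.M.smult_l_distr A.M.smult_r_distr A.M.smult_assoc1 A.M.smult_diff
    A.M.M.diff_simps A.M.M.diff_eq_iff A.M.M.a_ac)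

text \<open>A class acts through any term in it, which is well defined by
  \<open>term_act_eqv\<close>. The statement repeats the definite description in
  \<open>coproduct_act\<close>, so that \<open>theI'\<close> yields its properties.\<close>

lemma ex1_coproduct_act:
  "\<exists>!c. lie_action R (lie_coproduct R M N) L c \<and>
    c \<in> carrier (lie_coproduct R M N) \<rightarrow>\<^sub>E (carrier L \<rightarrow>\<^sub>E carrier L) \<and>
    (\<forall>m\<in>carrier M. \<forall>x\<in>carrier L. c (coproduct_inM R M N m) x = a m x) \<and>
    (\<forall>n\<in>carrier N. \<forall>x\<in>carrier L. c (coproduct_inN R M N n) x = b n x)"
proof -
  let ?S = "lie_coproduct R M N" and ?C = "lie_class R M N"
  note simps = coproduct_carrier[OF MN] coproduct_zero[OF MN] coproduct_add[OF MN]
    coproduct_smult[OF MN] coproduct_bracket[OF MN]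
  define c where "c = (\<lambda>A\<in>carrier ?S. \<lambda>x\<in>carrier L. \<tau> (SOME t. t \<in> A) x)"
  have c: "c (?C t) x = \<tau> t x" if "t \<in> lie_terms R M N" "x \<in> carrier L" for t x
  proof -
    have "t \<in> ?C t" by (simp add: lie_class_def lie_eqv.refl that)
    then have "(SOME s. s \<in> ?C t) \<in> ?C t" by (rule someI)
    then have "lie_eqv R M N t (SOME s. s \<in> ?C t)" by (simp only: lie_class_def mem_Collect_eq)
    from term_act_eqv[OF this that(2)] show ?thesis
      using that by (simp add: c_def simps)
  qed
  show ?thesis
  proof (rule ex1I[of _ c], intro conjI)
    show "lie_action R ?S L c"
      by (intro lie_action.intro lie_action_axioms.intro lie_algebra_coproduct[OF MN]
          A.M.lie_algebra_axioms)
        (auto simp: simps c term_act_closed term_act_add term_act_smult term_act_bracket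
          lie_terms.intros)
    show "c \<in> carrier ?S \<rightarrow>\<^sub>E (carrier L \<rightarrow>\<^sub>E carrier L)"
      by (rule PiE_I, rule PiE_I) (auto simp: simps c term_act_closed, auto simp: c_def simps)
    show "\<forall>m\<in>carrier M. \<forall>x\<in>carrier L. c (coproduct_inM R M N m) x = a m x"
      by (simp add: coproduct_inM_def c lie_terms.intros)
    show "\<forall>n\<in>carrier N. \<forall>x\<in>carrier L. c (coproduct_inN R M N n) x = b n x"
      by (simp add: coproduct_inN_def c lie_terms.intros)
    then have cN: "\<And>n x. n \<in> carrier N \<Longrightarrow> x \<in> carrier L \<Longrightarrow> c (coproduct_inN R M N n) x = b n x"
      by blast
    fix c'
    assume c': "lie_action R ?S L c' \<and> c' \<in> carrier ?S \<rightarrow>\<^sub>E (carrier L \<rightarrow>\<^sub>E carrier L) \<and>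
      (\<forall>m\<in>carrier M. \<forall>x\<in>carrier L. c' (coproduct_inM R M N m) x = a m x) \<and>
      (\<forall>n\<in>carrier N. \<forall>x\<in>carrier L. c' (coproduct_inN R M N n) x = b n x)"
    interpret c: lie_action R ?S L c by fact
    interpret c': lie_action R ?S L c' using c' by blast
    \<comment> \<open>The action laws determine the values on sums, multiples and brackets from
      those on the generators. The quantifier over x belongs to the induction because the bracket
      case evaluates one action at values of the other factor.\<close>
    have agree: "\<forall>x\<in>carrier L. c' s x = c s x" if "s \<in> carrier ?S" for s
      using MN that
    proof (induction rule: coproduct_induct)
      case (inM m)
      then show ?case using c' by (simp add: coproduct_inM_def c lie_terms.intros)
    next
      case (inN n)
      then show ?case using c' cN by simp
    qed (simp_all add: c.act_closed c.act_add_left c'.act_add_left c.act_smult_left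
        c'.act_smult_left c.act_bracket_left c'.act_bracket_left)
    show "c' = c"
    proof (rule extensionalityI[of _ "carrier ?S"])
      fix s assume s: "s \<in> carrier ?S"
      show "c' s = c s"
        by (rule extensionalityI[of _ "carrier L"])
          (use s c' agree in \<open>auto simp: PiE_iff\<close>, simp add: c_def)
    qed (use c' in \<open>auto simp: PiE_iff c_def\<close>)
  qed
qed

lemmas coproduct_act = theI'[OF ex1_coproduct_act, folded coproduct_act_def]

end

section \<open>The Peiffer product and its crossed modules\<close>

locale peiffer_pair =
  M: lie_algebra R M + N: lie_algebra R N +
  MN: lie_action R M N \<alpha> + NM: lie_action R N M \<beta>
  for R :: "('r, 'x) ring_scheme" (structure)
    and M :: "('r, 'm, 'y) lie_algebra_scheme"
    and N :: "('r, 'n, 'z) lie_algebra_scheme"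
    and \<alpha> :: "'m \<Rightarrow> 'n \<Rightarrow> 'n"
    and \<beta> :: "'n \<Rightarrow> 'm \<Rightarrow> 'm"
begin

abbreviation "S \<equiv> lie_coproduct R M N"
abbreviation "iM \<equiv> coproduct_inM R M N"
abbreviation "iN \<equiv> coproduct_inN R M N"
abbreviation "K \<equiv> peiffer_ideal R M N \<alpha> \<beta>"
abbreviation "Q \<equiv> peiffer_product R M N \<alpha> \<beta>"
abbreviation "q \<equiv> peiffer_quot R M N \<alpha> \<beta>"

lemmas M_N = M.lie_algebra_axioms N.lie_algebra_axioms

sublocale S: lie_algebra R S
  by (rule lie_algebra_coproduct[OF M_N])

lemma in_closed [simp]: "m \<in> carrier M \<Longrightarrow> iM m \<in> carrier S" "n \<in> carrier N \<Longrightarrow> iN n \<in> carrier S"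
  using coproduct_inM_hom[OF M_N] coproduct_inN_hom[OF M_N] by (auto simp: lie_hom_def)

lemma peiffer_generators:
  assumes "m \<in> carrier M" "n \<in> carrier N"
  shows "iM (\<beta> n m) \<ominus>\<^bsub>S\<^esub> \<lbrakk>iN n, iM m\<rbrakk>\<^bsub>S\<^esub> \<in> K"
    and "iN (\<alpha> m n) \<ominus>\<^bsub>S\<^esub> \<lbrakk>iM m, iN n\<rbrakk>\<^bsub>S\<^esub> \<in> K"
  using assms unfolding peiffer_ideal_def gen_lie_ideal_def Let_def by blast+

text \<open>Minimality of the generated ideal. With the annihilator of a coproduct action as
  \<open>I\<close> it shows that \<open>K\<close> acts trivially.\<close>

lemma peiffer_ideal_subset:
  assumes "lie_ideal R S I"
    and "\<And>m n. m \<in> carrier M \<Longrightarrow> n \<in> carrier N \<Longrightarrow> iM (\<beta> n m) \<ominus>\<^bsub>S\<^esub> \<lbrakk>iN n, iM m\<rbrakk>\<^bsub>S\<^esub> \<in> I"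
    and "\<And>m n. m \<in> carrier M \<Longrightarrow> n \<in> carrier N \<Longrightarrow> iN (\<alpha> m n) \<ominus>\<^bsub>S\<^esub> \<lbrakk>iM m, iN n\<rbrakk>\<^bsub>S\<^esub> \<in> I"
  shows "K \<subseteq> I"
proof -
  have "I \<in> {I. lie_ideal R S I \<and>
      {iM (\<beta> n m) \<ominus>\<^bsub>S\<^esub> \<lbrakk>iN n, iM m\<rbrakk>\<^bsub>S\<^esub> | m n. m \<in> carrier M \<and> n \<in> carrier N} \<union>
      {iN (\<alpha> m n) \<ominus>\<^bsub>S\<^esub> \<lbrakk>iM m, iN n\<rbrakk>\<^bsub>S\<^esub> | m n. m \<in> carrier M \<and> n \<in> carrier N} \<subseteq> I}"
    using assms by auto
  then show ?thesis
    unfolding peiffer_ideal_def gen_lie_ideal_def Let_def by (rule Inter_lower)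
qed

lemma lie_ideal_peiffer: "lie_ideal R S K"
  unfolding peiffer_ideal_def Let_def
  by (rule S.lie_ideal_gen_lie_ideal) (auto simp: MN.act_closed NM.act_closed)

sublocale Q: lie_algebra R Q
  unfolding peiffer_product_def by (rule S.lie_algebra_quotient[OF lie_ideal_peiffer])

lemma peiffer_quot_hom: "q \<in> lie_hom R S Q"
  using S.coset_lie_hom[OF lie_ideal_peiffer]
  by (simp add: peiffer_product_def peiffer_quot_def[abs_def])

lemma q_closed [simp]: "s \<in> carrier S \<Longrightarrow> q s \<in> carrier Q"
  using peiffer_quot_hom by (auto simp: lie_hom_def)

lemma q_bracket: "s \<in> carrier S \<Longrightarrow> t \<in> carrier S \<Longrightarrow> q \<lbrakk>s, t\<rbrakk>\<^bsub>S\<^esub> = \<lbrakk>q s, q t\<rbrakk>\<^bsub>Q\<^esub>"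
  using peiffer_quot_hom by (auto simp: lie_hom_def)

lemma carrier_peiffer: "carrier Q = q ` carrier S"
  by (auto simp: peiffer_product_def peiffer_quot_def S.lie_quotient_carrier[OF lie_ideal_peiffer])

lemma q_eqI: "s \<ominus>\<^bsub>S\<^esub> t \<in> K \<Longrightarrow> s \<in> carrier S \<Longrightarrow> t \<in> carrier S \<Longrightarrow> q s = q t"
  unfolding peiffer_quot_def by (rule S.coset_eqI[OF lie_ideal_peiffer])

text \<open>The generators of \<open>K\<close> vanish in the quotient, so the given actions become
  brackets there. These are the mixed cases of equivariance on generators.\<close>

lemma q_act:
  assumes "m \<in> carrier M" "n \<in> carrier N"
  shows "q (iM (\<beta> n m)) = \<lbrakk>q (iN n), q (iM m)\<rbrakk>\<^bsub>Q\<^esub>"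
    and "q (iN (\<alpha> m n)) = \<lbrakk>q (iM m), q (iN n)\<rbrakk>\<^bsub>Q\<^esub>"
  using assms peiffer_generators[OF assms, THEN q_eqI]
  by (simp_all add: q_bracket MN.act_closed NM.act_closed)

text \<open>Treats both crossed modules at once, with \<open>L\<close> standing for M or N and
  \<open>j\<close> for its inclusion. The hypotheses \<open>trivial_M\<close> and
  \<open>trivial_N\<close> say that the two kinds of generators of \<open>K\<close> act as zero; the
  last two are equivariance for p in the images of M and N.\<close>

lemma lie_crossed_module_peiffer:
  assumes A: "lie_action R M L a" and B: "lie_action R N L b"
    and trivial_M: "\<And>m n x. \<lbrakk>m \<in> carrier M; n \<in> carrier N; x \<in> carrier L\<rbrakk> \<Longrightarrow>
      a (\<beta> n m) x = b n (a m x) \<ominus>\<^bsub>L\<^esub> a m (b n x)"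
    and trivial_N: "\<And>m n x. \<lbrakk>m \<in> carrier M; n \<in> carrier N; x \<in> carrier L\<rbrakk> \<Longrightarrow>
      b (\<alpha> m n) x = a m (b n x) \<ominus>\<^bsub>L\<^esub> b n (a m x)"
    and j: "j \<in> lie_hom R L S"
    and peiffer: "\<And>x y. \<lbrakk>x \<in> carrier L; y \<in> carrier L\<rbrakk> \<Longrightarrow>
      coproduct_act R M N L a b (j x) y = \<lbrakk>x, y\<rbrakk>\<^bsub>L\<^esub>"
    and equivariant_M: "\<And>m x. \<lbrakk>m \<in> carrier M; x \<in> carrier L\<rbrakk> \<Longrightarrow>
      q (j (a m x)) = \<lbrakk>q (iM m), q (j x)\<rbrakk>\<^bsub>Q\<^esub>"
    and equivariant_N: "\<And>n x. \<lbrakk>n \<in> carrier N; x \<in> carrier L\<rbrakk> \<Longrightarrow>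
      q (j (b n x)) = \<lbrakk>q (iN n), q (j x)\<rbrakk>\<^bsub>Q\<^esub>"
  shows "lie_crossed_module R L Q (q \<circ> j) (peiffer_act R M N \<alpha> \<beta> L (coproduct_act R M N L a b))"
proof -
  define c where "c = coproduct_act R M N L a b"
  define \<xi> where "\<xi> = peiffer_act R M N \<alpha> \<beta> L c"
  interpret pair: lie_action_pair R M N L a b
    by (intro lie_action_pair.intro A B)
  interpret c: lie_action R S L c
    using pair.coproduct_act unfolding c_def by blast
  have c_M: "c (iM m) x = a m x" if "m \<in> carrier M" "x \<in> carrier L" for m x
    using pair.coproduct_act that unfolding c_def by blast
  have c_N: "c (iN n) x = b n x" if "n \<in> carrier N" "x \<in> carrier L" for n x
    using pair.coproduct_act that unfolding c_def by blast
  have c_diff: "c (s \<ominus>\<^bsub>S\<^esub> t) x = c s x \<ominus>\<^bsub>L\<^esub> c t x"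
    if "s \<in> carrier S" "t \<in> carrier S" "x \<in> carrier L" for s t x
    using that by (simp add: S.M.minus_eq pair.A.M.M.minus_eq c.act_add_left c.act_minus_left)
  have "K \<subseteq> {s \<in> carrier S. \<forall>x\<in>carrier L. c s x = \<zero>\<^bsub>L\<^esub>}"
    by (rule peiffer_ideal_subset[OF c.lie_ideal_annihilator])
      (auto simp: c_diff c.act_bracket_left c_M c_N MN.act_closed NM.act_closed trivial_M trivial_N
        pair.A.act_closed pair.B.act_closed pair.A.M.M.minus_eq pair.A.M.M.r_neg)
  \<comment> \<open>After unfolding, \<open>peiffer_act\<close> is the definite description
    justified by \<open>ex1_quotient_action\<close> with \<open>K\<close> as the ideal.\<close>
  then have \<xi>: "lie_action R Q L \<xi>"
    and \<xi>_q: "\<And>s x. s \<in> carrier S \<Longrightarrow> x \<in> carrier L \<Longrightarrow> \<xi> (q s) x = c s x"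
    using theI'[OF c.ex1_quotient_action[OF lie_ideal_peiffer]]
    unfolding \<xi>_def peiffer_act_def peiffer_product_def peiffer_quot_def by blast+
  have d: "q \<circ> j \<in> lie_hom R L Q"
    using j peiffer_quot_hom by (rule lie_hom_comp)
  have d_closed: "q (j x) \<in> carrier Q" if "x \<in> carrier L" for x
    using d that by (auto simp: lie_hom_def)
  have d_add: "q (j (x \<oplus>\<^bsub>L\<^esub> y)) = q (j x) \<oplus>\<^bsub>Q\<^esub> q (j y)" if "x \<in> carrier L" "y \<in> carrier L" for x y
    using d that by (auto simp: lie_hom_def)
  have d_smult: "q (j (r \<odot>\<^bsub>L\<^esub> x)) = r \<odot>\<^bsub>Q\<^esub> q (j x)" if "r \<in> carrier R" "x \<in> carrier L" for r x
    using d that by (auto simp: lie_hom_def)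
  have d_zero: "q (j \<zero>\<^bsub>L\<^esub>) = \<zero>\<^bsub>Q\<^esub>"
    using lie_hom_zero[OF pair.A.M.lie_algebra_axioms Q.lie_algebra_axioms d] by simp
  have d_diff: "q (j (x \<ominus>\<^bsub>L\<^esub> y)) = q (j x) \<ominus>\<^bsub>Q\<^esub> q (j y)" if "x \<in> carrier L" "y \<in> carrier L" for x y
    using lie_hom_diff[OF pair.A.M.lie_algebra_axioms Q.lie_algebra_axioms d that] by simp
  have q_add: "q (s \<oplus>\<^bsub>S\<^esub> t) = q s \<oplus>\<^bsub>Q\<^esub> q t" if "s \<in> carrier S" "t \<in> carrier S" for s t
    using peiffer_quot_hom that by (auto simp: lie_hom_def)
  have q_smult: "q (r \<odot>\<^bsub>S\<^esub> s) = r \<odot>\<^bsub>Q\<^esub> q s" if "r \<in> carrier R" "s \<in> carrier S" for r s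
    using peiffer_quot_hom that by (auto simp: lie_hom_def)
  have q_zero: "q \<zero>\<^bsub>S\<^esub> = \<zero>\<^bsub>Q\<^esub>"
    by (rule lie_hom_zero[OF S.lie_algebra_axioms Q.lie_algebra_axioms peiffer_quot_hom])
  \<comment> \<open>For a bracket [s, t] both sides become commutators: on the left by the action
    law, on the right by the Jacobi identity in \<open>Q\<close>.\<close>
  have equivariant: "\<forall>x\<in>carrier L. q (j (c s x)) = \<lbrakk>q s, q (j x)\<rbrakk>\<^bsub>Q\<^esub>" if "s \<in> carrier S" for s
    using M_N that
    by (induction rule: coproduct_induct)
      (simp_all add: c_M c_N equivariant_M equivariant_N c.act_closed c.act_add_left
        c.act_smult_left c.act_bracket_left d_closed d_add d_smult d_zero d_diff
        q_add q_smult q_zero q_bracket Q.bracket_add_left Q.bracket_smult_left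
        Q.bracket_bracket_left)
  have "lie_crossed_module R L Q (q \<circ> j) \<xi>"
  proof (intro lie_crossed_module.intro lie_crossed_module_axioms.intro \<xi> d)
    fix x y assume "x \<in> carrier L" "y \<in> carrier L"
    moreover from this have "j x \<in> carrier S"
      using j by (auto simp: lie_hom_def)
    ultimately show "\<xi> ((q \<circ> j) x) y = \<lbrakk>x, y\<rbrakk>\<^bsub>L\<^esub>"
      by (simp add: \<xi>_q c_def peiffer)
  next
    fix p x assume "p \<in> carrier Q" "x \<in> carrier L"
    then show "(q \<circ> j) (\<xi> p x) = \<lbrakk>p, (q \<circ> j) x\<rbrakk>\<^bsub>Q\<^esub>"
      using equivariant by (auto simp: carrier_peiffer \<xi>_q)
  qed
  then show ?thesis
    by (simp only: \<xi>_def c_def)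
qed

end

theorem proposition2p16:
  fixes R :: "('r, 'x) ring_scheme"
    and M :: "('r, 'm, 'y) lie_algebra_scheme"
    and N :: "('r, 'n, 'z) lie_algebra_scheme"
    and \<alpha> :: "'m \<Rightarrow> 'n \<Rightarrow> 'n"
    and \<beta> :: "'n \<Rightarrow> 'm \<Rightarrow> 'm"
  assumes "cring R"
    and "lie_algebra R M"
    and "lie_algebra R N"
    and "lie_action R M N \<alpha>"
    and "lie_action R N M \<beta>"
    and "compatible_actions M N \<alpha> \<beta>"
  shows "lie_crossed_module R M (peiffer_product R M N \<alpha> \<beta>)
           (peiffer_quot R M N \<alpha> \<beta> \<circ> coproduct_inM R M N) (peiffer_act_M R M N \<alpha> \<beta>) \<and>
         lie_crossed_module R N (peiffer_product R M N \<alpha> \<beta>)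
           (peiffer_quot R M N \<alpha> \<beta> \<circ> coproduct_inN R M N) (peiffer_act_N R M N \<alpha> \<beta>)"
proof -
  interpret peiffer_pair R M N \<alpha> \<beta>
    by (intro peiffer_pair.intro assms)
  have \<alpha>_\<beta>: "\<alpha> (\<beta> n m) n' = \<lbrakk>n', \<alpha> m n\<rbrakk>\<^bsub>N\<^esub>"
    if "m \<in> carrier M" "n \<in> carrier N" "n' \<in> carrier N" for m n n'
    using assms(6) that by (auto simp: compatible_actions_def)
  have \<beta>_\<alpha>: "\<beta> (\<alpha> m n) m' = \<lbrakk>m', \<beta> n m\<rbrakk>\<^bsub>M\<^esub>"
    if "m \<in> carrier M" "m' \<in> carrier M" "n \<in> carrier N" for m m' n
    using assms(6) that by (auto simp: compatible_actions_def)
  interpret MM: lie_action_pair R M N M "bracket M" \<beta>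
    by (intro lie_action_pair.intro M.lie_action_bracket assms)
  interpret NN: lie_action_pair R M N N \<alpha> "bracket N"
    by (intro lie_action_pair.intro N.lie_action_bracket assms)
  have "lie_crossed_module R M Q (q \<circ> iM) (peiffer_act_M R M N \<alpha> \<beta>)"
    unfolding peiffer_act_M_def
  proof (rule lie_crossed_module_peiffer[OF M.lie_action_bracket NM.lie_action_axioms])
    fix m n x assume x: "m \<in> carrier M" "n \<in> carrier N" "x \<in> carrier M"
    \<comment> \<open>This is the Leibniz rule for the action of n on [m, x].\<close>
    then show "\<lbrakk>\<beta> n m, x\<rbrakk>\<^bsub>M\<^esub> = \<beta> n \<lbrakk>m, x\<rbrakk>\<^bsub>M\<^esub> \<ominus>\<^bsub>M\<^esub> \<lbrakk>m, \<beta> n x\<rbrakk>\<^bsub>M\<^esub>"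
      by (simp add: NM.act_bracket_right NM.act_closed M.M.diff_eq_iff)
    \<comment> \<open>Compatibility turns the left side into [x, \<open>\<beta> n m\<close>] =
      -[\<open>\<beta> n m\<close>, x], so this is the previous identity with opposite sign.\<close>
    show "\<beta> (\<alpha> m n) x = \<lbrakk>m, \<beta> n x\<rbrakk>\<^bsub>M\<^esub> \<ominus>\<^bsub>M\<^esub> \<beta> n \<lbrakk>m, x\<rbrakk>\<^bsub>M\<^esub>"
      using x M.bracket_anti[of "\<beta> n m" x]
      by (simp add: \<beta>_\<alpha> NM.act_bracket_right NM.act_closed M.M.diff_eq_iff M.M.l_neg
          M.M.a_assoc[symmetric])
  \<comment> \<open>The Peiffer identity holds because the coproduct action restricts to the bracket
    on M. Equivariance is multiplicativity of \<open>q\<close> and \<open>iM\<close> for p from M,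
    and \<open>q_act\<close> for p from N.\<close>
  qed (use MM.coproduct_act coproduct_inM_hom[OF M_N] in
      \<open>auto simp: lie_hom_def q_bracket q_act\<close>)
  moreover have "lie_crossed_module R N Q (q \<circ> iN) (peiffer_act_N R M N \<alpha> \<beta>)"
    unfolding peiffer_act_N_def
  proof (rule lie_crossed_module_peiffer[OF MN.lie_action_axioms N.lie_action_bracket])
    fix m n x assume x: "m \<in> carrier M" "n \<in> carrier N" "x \<in> carrier N"
    then show "\<lbrakk>\<alpha> m n, x\<rbrakk>\<^bsub>N\<^esub> = \<alpha> m \<lbrakk>n, x\<rbrakk>\<^bsub>N\<^esub> \<ominus>\<^bsub>N\<^esub> \<lbrakk>n, \<alpha> m x\<rbrakk>\<^bsub>N\<^esub>"
      by (simp add: MN.act_bracket_right MN.act_closed N.M.diff_eq_iff)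
    \<comment> \<open>The roles are exchanged: here the generators with \<open>\<beta>\<close> are
      the ones that act trivially by compatibility, those with \<open>\<alpha>\<close> by the
      Leibniz rule.\<close>
    show "\<alpha> (\<beta> n m) x = \<lbrakk>n, \<alpha> m x\<rbrakk>\<^bsub>N\<^esub> \<ominus>\<^bsub>N\<^esub> \<alpha> m \<lbrakk>n, x\<rbrakk>\<^bsub>N\<^esub>"
      using x N.bracket_anti[of "\<alpha> m n" x]
      by (simp add: \<alpha>_\<beta> MN.act_bracket_right MN.act_closed N.M.diff_eq_iff N.M.l_neg
          N.M.a_assoc[symmetric])
  qed (use NN.coproduct_act coproduct_inN_hom[OF M_N] in
      \<open>auto simp: lie_hom_def q_bracket q_act\<close>)
  ultimately show ?thesis ..
qed

end
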